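(* Let $\mathbf{H}\in\mathbb{C}^{K\times N}$ have full row rank $K\le N$, $\bar{\mathbf{H}}=\mathbf{H}\mathbf{H}^{\mathsf H}$, and fix a weight $\eta\in(0,1)$ and constants $R_{\mathrm{ref}},\mathrm{EE}_{\mathrm{ref}}>0$. Consider the weighted-sum problem $$\text{(T)}\quad\max_{\mathbf{Y},\mathbf{p}\ge\mathbf{0}}\ \eta\frac{R}{R_{\mathrm{ref}}}+(1-\eta)\frac{1}{\mathrm{EE}_{\mathrm{ref}}}\frac{B R}{P_{\mathrm{tot}}(\mathbf{p})}\quad\text{s.t. }\|\mathbf{Y}\|_2\le1,\ \alpha_q\mathbf{1}^{\mathsf T}\mathbf{p}\le P_{\max},$$ where $R$ is evaluated at $\mathbf{W}=\mathbf{H}^{\mathsf H}\bar{\mathbf{H}}^{-1/2}\mathbf{Y}\operatorname{diag}(\sqrt{\mathbf{p}})$, and its lifted form over $\mathbf{X}\in\mathbb{C}^{K\times K}$, $\mathbf{p}\in\mathbb{R}^K$ and $r,t,x,y\ge0$ (with $\mathbf{W}=\mathbf{H}^{\mathsf H}\mathbf{X}$), $$\text{(L)}\quad\max\ \eta\frac{r}{R_{\mathrm{ref}}}+(1-\eta)\frac{t}{\mathrm{EE}_{\mathrm{ref}}}\quad\text{s.t. } r\le R(\mathbf{X}),\ t\le\frac{Bx^2}{y},\ x^2\le r,\ \mathbf{X}^{\mathsf H}\bar{\mathbf{H}}\mathbf{X}\preceq\operatorname{diag}(\mathbf{p}),\ \frac{\alpha_q\mathbf{1}^{\mathsf T}\mathbf{p}}{\eta_{\mathrm{PA}}}+P_{\mathrm{st}}\le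 y,\ \alpha_q\mathbf{1}^{\mathsf T}\mathbf{p}\le P_{\max}.$$ Let the sequence $(\mathbf{X}^{(n)},\mathbf{p}^{(n)},r^{(n)},t^{(n)},x^{(n)},y^{(n)})$ be generated by the successive convex approximation scheme: start from $(\mathbf{X}^{(0)},\mathbf{p}^{(0)})$ satisfying the constraints on $(\mathbf{X},\mathbf{p})$ in (L), with $r^{(0)}=R(\mathbf{X}^{(0)})$, $x^{(0)}=\sqrt{r^{(0)}}$, $y^{(0)}=P_{\mathrm{tot}}(\mathbf{p}^{(0)})$, $t^{(0)}=B(x^{(0)})^2/y^{(0)}$; the $(n+1)$st iterate is a maximizer of the problem obtained from (L) by replacing $r\le R(\mathbf{X})$ by $r\le\tilde R^{(n)}(\mathbf{X})$ and $t\le Bx^2/y$ by $t\le B\phi^{(n)}(x,y)$. Then: each such subproblem is a convex program for which the current iterate is feasible; all iterates are feasible for (L); the objective values of (L) along the iterates are monotonically nondecreasing and converge; and every limit point of the iterates satisfies the KKT conditions of (T), where $\mathbf{X}$ and $\mathbf{Y}$ are identified through $\mathbf{W}=\mathbf{H}^{\mathsf H}\mathbf{X}=\mathbf{H}^{\mathsf H}\bar{\mathbf{H}}^{-1/2}\mathbf{Y}\operatorname{diag}(\sqrt{\mathbf{p}})$.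
   Context: Constants: $B>0$, $\sigma^2>0$, $P_{\max}>0$, $\eta_{\mathrm{PA}}>0$, $P_{\mathrm{st}}>0$ (static power), $\beta_q\in(0,1)$ and $\alpha_q=1-\beta_q$. $\preceq$ is the Loewner order, $\|\cdot\|_2$ the spectral norm, $\bar{\mathbf{H}}^{-1/2}$ the inverse Hermitian positive definite square root, $\sqrt{\mathbf{p}}$ the entrywise square root. $P_{\mathrm{tot}}(\mathbf{p})=\alpha_q\mathbf{1}^{\mathsf T}\mathbf{p}/\eta_{\mathrm{PA}}+P_{\mathrm{st}}$. Rate: with $\mathbf{C}=\mathbf{H}\mathbf{W}$ (so $\mathbf{C}=\bar{\mathbf{H}}\mathbf{X}$ when $\mathbf{W}=\mathbf{H}^{\mathsf H}\mathbf{X}$) having entries $C_{k,j}$, $$R=\sum_{k=1}^K\log_2\Bigl(1+\frac{\alpha_q^2|C_{k,k}|^2}{\alpha_q^2\sum_{j\neq k}|C_{k,j}|^2+\alpha_q\beta_q\sum_{j=1}^K|C_{k,j}|^2+\sigma^2}\Bigr),$$ written $R(\mathbf{X})$ when $\mathbf{C}=\bar{\mathbf{H}}\mathbf{X}$. Mean-square errors: for $\mathbf{u}\in\mathbb{C}^K$ and $\mathbf{C}=\bar{\mathbf{H}}\mathbf{X}$, $$e_k(\mathbf{X};\mathbf{u})=|1-\alpha_qu_kC_{k,k}|^2+\alpha_q^2|u_k|^2\sum_{j\ne k}|C_{k,j}|^2+\alpha_q\beta_q|u_k|^2\sum_{j=1}^K|C_{k,j}|^2+\sigma^2|u_k|^2.$$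 Minorizers at iteration $n$: with $C^{(n)}_{k,j}$ the entries of $\bar{\mathbf{H}}\mathbf{X}^{(n)}$, set $u_k^{(n)}=\alpha_q\overline{C^{(n)}_{k,k}}/(\alpha_q\sum_{j}|C^{(n)}_{k,j}|^2+\sigma^2)$, $\omega_k^{(n)}=1/e_k(\mathbf{X}^{(n)};\mathbf{u}^{(n)})$, and $$\tilde R^{(n)}(\mathbf{X})=\frac1{\ln2}\sum_{k=1}^K\bigl[\ln\omega_k^{(n)}+1-\omega_k^{(n)}e_k(\mathbf{X};\mathbf{u}^{(n)})\bigr],\qquad \phi^{(n)}(x,y)=\frac{2x^{(n)}}{y^{(n)}}x-\Bigl(\frac{x^{(n)}}{y^{(n)}}\Bigr)^2y.$$
   Formalization: The KKT claim for limit points is proved assuming x^(n) > 0 for some n (automatic if R(X^(0)) > 0), as it can fail when x^(n) = 0 throughout; it asserts KKT for some Y satisfying the identification (Y is not unique where p_k = 0). *)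

theory Defs
  imports "HOL-Analysis.Analysis"
begin

section \<open>Complex matrices\<close>

definition ctranspose :: "complex^'n^'m \<Rightarrow> complex^'m^'n" where
  "ctranspose A = (\<chi> i j. cnj (A $ j $ i))"

definition quad_form :: "complex^'k^'k \<Rightarrow> complex^'k \<Rightarrow> complex" where
  "quad_form A v = (\<Sum>i\<in>UNIV. cnj (v $ i) * (A *v v) $ i)"

definition hermitian :: "complex^'k^'k \<Rightarrow> bool" where
  "hermitian A \<longleftrightarrow> ctranspose A = A"

definition pos_semidef :: "complex^'k^'k \<Rightarrow> bool" where
  "pos_semidef A \<longleftrightarrow> hermitian A \<and> (\<forall>v. 0 \<le> Re (quad_form A v))"

definition pos_def :: "complex^'k^'k \<Rightarrow> bool" where
  "pos_def A \<longleftrightarrow> hermitian A \<and> (\<forall>v. v \<noteq> 0 \<longrightarrow> 0 < Re (quad_form A v))"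

definition loewner_le :: "complex^'k^'k \<Rightarrow> complex^'k^'k \<Rightarrow> bool" where
  "loewner_le A B \<longleftrightarrow> pos_semidef (B - A)"

text \<open>The operator norm for the Euclidean norms, i.e. the largest singular value.\<close>

definition spectral_norm :: "complex^'n^'m \<Rightarrow> real" where
  "spectral_norm A = onorm (\<lambda>v. A *v v)"

definition diag_mat :: "real^'k \<Rightarrow> complex^'k^'k" where
  "diag_mat p = (\<chi> i j. if i = j then complex_of_real (p $ i) else 0)"

definition sqrt_vec :: "real^'k \<Rightarrow> real^'k" where
  "sqrt_vec p = (\<chi> k. sqrt (p $ k))"

definition herm_sqrt :: "complex^'k^'k \<Rightarrow> complex^'k^'k" where
  "herm_sqrt A = (THE S. pos_def S \<and> S ** S = A)"

definition herm_inv_sqrt :: "complex^'k^'k \<Rightarrow> complex^'k^'k" where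
  "herm_inv_sqrt A = matrix_inv (herm_sqrt A)"

definition gram :: "complex^'n^'k \<Rightarrow> complex^'k^'k" where
  "gram H = H ** ctranspose H"


section \<open>Convex programs with a Loewner constraint\<close>

text \<open>
  The program: maximize \<open>objective z\<close> subject to \<open>g z \<le> 0\<close> for all \<open>g \<in> ineqs\<close>
  and \<open>lmi z \<preceq> 0\<close>.
\<close>

record ('z, 'k) program =
  objective :: "'z \<Rightarrow> real"
  ineqs :: "('z \<Rightarrow> real) set"
  lmi :: "'z \<Rightarrow> complex^'k^'k"

definition feasible :: "('z, 'k::finite) program \<Rightarrow> 'z \<Rightarrow> bool" where
  "feasible P z \<longleftrightarrow> (\<forall>g\<in>ineqs P. g z \<le> 0) \<and> loewner_le (lmi P z) 0"

definition loewner_convex :: "('z::real_vector \<Rightarrow> complex^'k^'k) \<Rightarrow> bool" where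
  "loewner_convex G \<longleftrightarrow>
     (\<forall>a b u v. 0 \<le> u \<longrightarrow> 0 \<le> v \<longrightarrow> u + v = 1 \<longrightarrow>
        loewner_le (G (u *\<^sub>R a + v *\<^sub>R b)) (u *\<^sub>R G a + v *\<^sub>R G b))"

definition convex_program :: "('z::real_vector, 'k::finite) program \<Rightarrow> bool" where
  "convex_program P \<longleftrightarrow>
     concave_on UNIV (objective P) \<and> (\<forall>g\<in>ineqs P. convex_on UNIV g) \<and> loewner_convex (lmi P)"

definition maximizer :: "('z, 'k::finite) program \<Rightarrow> 'z \<Rightarrow> bool" where
  "maximizer P z \<longleftrightarrow> is_arg_max (objective P) (feasible P) z"


section \<open>System model\<close>

record system =
  bandwidth :: real    \<comment> \<open>\<open>B\<close>\<close>
  noise_var :: real    \<comment> \<open>\<open>\<sigma>\<^sup>2\<close>\<close>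
  p_max :: real
  pa_eff :: real       \<comment> \<open>\<open>\<eta>\<^sub>P\<^sub>A\<close>\<close>
  p_static :: real
  beta_q :: real
  weight :: real       \<comment> \<open>\<open>\<eta>\<close>\<close>
  R_ref :: real
  EE_ref :: real

definition alpha_q :: "system \<Rightarrow> real" where
  "alpha_q s = 1 - beta_q s"

definition valid_system :: "system \<Rightarrow> bool" where
  "valid_system s \<longleftrightarrow>
     0 < bandwidth s \<and> 0 < noise_var s \<and> 0 < p_max s \<and> 0 < pa_eff s \<and> 0 < p_static s \<and>
     0 < beta_q s \<and> beta_q s < 1 \<and> 0 < weight s \<and> weight s < 1 \<and> 0 < R_ref s \<and> 0 < EE_ref s"

definition tx_power :: "system \<Rightarrow> real^'k \<Rightarrow> real" where
  "tx_power s p = alpha_q s * (\<Sum>k\<in>UNIV. p $ k)"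

definition P_tot :: "system \<Rightarrow> real^'k \<Rightarrow> real" where
  "P_tot s p = tx_power s p / pa_eff s + p_static s"

definition rate :: "system \<Rightarrow> complex^'k^'k \<Rightarrow> real" where
  "rate s C = (\<Sum>k\<in>UNIV. log 2 (1 +
     (alpha_q s)\<^sup>2 * (cmod (C $ k $ k))\<^sup>2 /
     ((alpha_q s)\<^sup>2 * (\<Sum>j\<in>UNIV - {k}. (cmod (C $ k $ j))\<^sup>2)
       + alpha_q s * beta_q s * (\<Sum>j\<in>UNIV. (cmod (C $ k $ j))\<^sup>2) + noise_var s)))"

definition mse :: "system \<Rightarrow> complex^'k^'k \<Rightarrow> complex^'k \<Rightarrow> 'k \<Rightarrow> real" where
  "mse s C u k =
     (cmod (1 - complex_of_real (alpha_q s) * u $ k * C $ k $ k))\<^sup>2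
     + (alpha_q s)\<^sup>2 * (cmod (u $ k))\<^sup>2 * (\<Sum>j\<in>UNIV - {k}. (cmod (C $ k $ j))\<^sup>2)
     + alpha_q s * beta_q s * (cmod (u $ k))\<^sup>2 * (\<Sum>j\<in>UNIV. (cmod (C $ k $ j))\<^sup>2)
     + noise_var s * (cmod (u $ k))\<^sup>2"


section \<open>Problem (T)\<close>

definition precoder_T :: "complex^'n^'k \<Rightarrow> complex^'k^'k \<Rightarrow> real^'k \<Rightarrow> complex^'k^'n" where
  "precoder_T H Y p = ctranspose H ** herm_inv_sqrt (gram H) ** Y ** diag_mat (sqrt_vec p)"

definition objective_T ::
  "system \<Rightarrow> complex^'n^'k \<Rightarrow> (complex^'k^'k) \<times> (real^'k) \<Rightarrow> real" where
  "objective_T s H = (\<lambda>(Y, p). let R = rate s (H ** precoder_T H Y p) in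
     weight s * (R / R_ref s)
     + (1 - weight s) * (1 / EE_ref s) * (bandwidth s * R / P_tot s p))"

definition feasible_T :: "system \<Rightarrow> (complex^'k^'k) \<times> (real^'k) \<Rightarrow> bool" where
  "feasible_T s = (\<lambda>(Y, p). (\<forall>k. 0 \<le> p $ k) \<and> spectral_norm Y \<le> 1 \<and> tx_power s p \<le> p_max s)"

definition subgradient :: "('a::real_inner \<Rightarrow> real) \<Rightarrow> 'a \<Rightarrow> 'a \<Rightarrow> bool" where
  "subgradient f x g \<longleftrightarrow> (\<forall>z. f x + inner g (z - x) \<le> f z)"

text \<open>
  KKT conditions of (T), with multipliers \<open>l\<close> for \<open>spectral_norm Y \<le> 1\<close>, \<open>m\<close> for the power
  budget and \<open>n\<close> for \<open>p \<ge> 0\<close>. The spectral norm is convex but not differentiable, so it enters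
  stationarity through a subgradient \<open>V\<close>. The pair \<open>(GY, gp)\<close> is the gradient of the objective
  for the real inner product; it is taken within \<open>{p \<ge> 0}\<close>, where \<open>sqrt_vec\<close> is meaningful
  (two-sided differentiation at \<open>p $ k = 0\<close> would see the value of \<open>sqrt\<close> on negative numbers).
  That set is convex with nonempty interior, so the gradient is unique.
\<close>

definition KKT_T :: "system \<Rightarrow> complex^'n^'k \<Rightarrow> (complex^'k^'k) \<times> (real^'k) \<Rightarrow> bool" where
  "KKT_T s H = (\<lambda>(Y, p). feasible_T s (Y, p) \<and>
     (\<exists>GY gp V l m n.
        (objective_T s H has_derivative (\<lambda>(dY, dp). inner GY dY + inner gp dp))
          (at (Y, p) within {(Y', p'). \<forall>k. 0 \<le> p' $ k}) \<and>
        0 \<le> l \<and> 0 \<le> m \<and> (\<forall>k. 0 \<le> n $ k) \<and>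
        subgradient spectral_norm Y V \<and>
        GY = l *\<^sub>R V \<and>
        (\<forall>k. gp $ k = m * alpha_q s - n $ k) \<and>
        l * (spectral_norm Y - 1) = 0 \<and>
        m * (tx_power s p - p_max s) = 0 \<and>
        (\<forall>k. n $ k * p $ k = 0)))"


section \<open>Lifted problem (L) and its convex surrogates\<close>

text \<open>Points \<open>(X, p, r, t, x, y)\<close>.\<close>

type_synonym 'k point = "(complex^'k^'k) \<times> (real^'k) \<times> real \<times> real \<times> real \<times> real"

text \<open>
  The common shape of (L) and the subproblems: \<open>r\<close> is bounded by \<open>\<rho> X\<close> and \<open>t\<close> by
  \<open>bandwidth s * \<tau> x y\<close>.
\<close>

definition lifted_program ::
  "system \<Rightarrow> complex^'k^'k \<Rightarrow> (complex^'k^'k \<Rightarrow> real) \<Rightarrow> (real \<Rightarrow> real \<Rightarrow> real)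
     \<Rightarrow> ('k point, 'k::finite) program" where
  "lifted_program s Hb \<rho> \<tau> = \<lparr>
     objective = (\<lambda>(X, p, r, t, x, y).
       weight s * (r / R_ref s) + (1 - weight s) * (t / EE_ref s)),
     ineqs = {
       (\<lambda>(X, p, r, t, x, y). r - \<rho> X),
       (\<lambda>(X, p, r, t, x, y). t - bandwidth s * \<tau> x y),
       (\<lambda>(X, p, r, t, x, y). x\<^sup>2 - r),
       (\<lambda>(X, p, r, t, x, y). P_tot s p - y),
       (\<lambda>(X, p, r, t, x, y). tx_power s p - p_max s),
       (\<lambda>(X, p, r, t, x, y). - r),
       (\<lambda>(X, p, r, t, x, y). - t),
       (\<lambda>(X, p, r, t, x, y). - x),
       (\<lambda>(X, p, r, t, x, y). - y)},
     lmi = (\<lambda>(X, p, r, t, x, y). ctranspose X ** Hb ** X - diag_mat p) \<rparr>"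

definition problem_L :: "system \<Rightarrow> complex^'k^'k \<Rightarrow> ('k point, 'k::finite) program" where
  "problem_L s Hb = lifted_program s Hb (\<lambda>X. rate s (Hb ** X)) (\<lambda>x y. x\<^sup>2 / y)"

definition mmse_receiver :: "system \<Rightarrow> complex^'k^'k \<Rightarrow> complex^'k" where
  "mmse_receiver s C = (\<chi> k. complex_of_real (alpha_q s) * cnj (C $ k $ k) /
     complex_of_real (alpha_q s * (\<Sum>j\<in>UNIV. (cmod (C $ k $ j))\<^sup>2) + noise_var s))"

definition rate_minorizer ::
  "system \<Rightarrow> complex^'k^'k \<Rightarrow> complex^'k^'k \<Rightarrow> complex^'k^'k \<Rightarrow> real" where
  "rate_minorizer s Hb Xn X = (let u = mmse_receiver s (Hb ** Xn) in
     1 / ln 2 * (\<Sum>k\<in>UNIV. let \<omega> = 1 / mse s (Hb ** Xn) u k in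
       ln \<omega> + 1 - \<omega> * mse s (Hb ** X) u k))"

definition ratio_minorizer :: "real \<Rightarrow> real \<Rightarrow> real \<Rightarrow> real \<Rightarrow> real" where
  "ratio_minorizer xn yn x y = 2 * xn / yn * x - (xn / yn)\<^sup>2 * y"

definition subproblem :: "system \<Rightarrow> complex^'k^'k \<Rightarrow> 'k point \<Rightarrow> ('k point, 'k::finite) program" where
  "subproblem s Hb = (\<lambda>(Xn, pn, rn, tn, xn, yn).
     lifted_program s Hb (rate_minorizer s Hb Xn) (ratio_minorizer xn yn))"

definition sca_init :: "system \<Rightarrow> complex^'k^'k \<Rightarrow> 'k::finite point \<Rightarrow> bool" where
  "sca_init s Hb = (\<lambda>(X, p, r, t, x, y).
     loewner_le (ctranspose X ** Hb ** X) (diag_mat p) \<and> tx_power s p \<le> p_max s \<and>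
     r = rate s (Hb ** X) \<and> x = sqrt r \<and> y = P_tot s p \<and> t = bandwidth s * x\<^sup>2 / y)"

definition sca_sequence :: "system \<Rightarrow> complex^'k^'k \<Rightarrow> (nat \<Rightarrow> 'k::finite point) \<Rightarrow> bool" where
  "sca_sequence s Hb z \<longleftrightarrow>
     sca_init s Hb (z 0) \<and> (\<forall>n. maximizer (subproblem s Hb (z n)) (z (Suc n)))"

text \<open>
  If \<open>x\<close> vanishes, then so does \<open>ratio_minorizer\<close>; hence \<open>t = 0\<close> in the next subproblem, whose
  maximizers may again have \<open>x = 0\<close>, and the energy efficiency term is never seen. Once \<open>x > 0\<close>
  holds (from the start if the initial rate is positive), it holds for all later iterates.
\<close>

definition x_part :: "'k::finite point \<Rightarrow> real" where
  "x_part = (\<lambda>(X, p, r, t, x, y). x)"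

definition limit_point :: "(nat \<Rightarrow> 'a::topological_space) \<Rightarrow> 'a \<Rightarrow> bool" where
  "limit_point z a \<longleftrightarrow> (\<exists>\<kappa>. strict_mono \<kappa> \<and> (z \<circ> \<kappa>) \<longlonglongrightarrow> a)"

end

(*
  Every subproblem minorizes (L) and touches it at the current iterate, which gives feasibility,
  monotonicity and (the rate being bounded) convergence. For stationarity no constraint
  qualification for (L) is needed. Maximality of the iterates passes to a limit point: there
  r = R(X), x = sqrt r, y = P_tot p hold, and no feasible point near it improves the surrogate
  built at it. Factor X = Hb^(-1/2) Y diag(sqrt p) with the columns of Y equal to 0 where p = 0.
  Along every curve through (Y, p) surrogate and objective of (T) have the same derivative, as one
  minorizes the other with contact, so the gradient of (T) is nonpositive on feasible directions.
  The multiplier of the spectral norm is then read off by varying Y in the unit ball, those of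
  the power constraints by moving power between the streams.
*)

theory Submission
  imports Defs
begin

section \<open>Hermitian matrices and the Loewner order\<close>

text \<open>The successor of a subsequence term need not approach the same limit point, so the limit
  is not shown to be a fixed point of the scheme. What survives is the objective value: it is
  nondecreasing, hence every iterate, successors included, stays below the value at the limit, and
  this bounds the surrogate built there. The argument needs \<open>r > 0\<close> at the limit:
  \<open>sqrt\<close> must be differentiable at \<open>r\<close>, and comparison points must stay
  feasible when the base point moves along the subsequence. A bound of \<open>t\<close> by a
  multiple of \<open>r\<close>, with monotonicity, keeps \<open>r\<close> away from zero. The
  obstacle in the last step is \<open>p $ j = 0\<close>: the lifted point depends on
  \<open>sqrt (p $ j)\<close>, so a curve along which this power leaves zero is not smooth. Such
  powers are held fixed in the comparison with the surrogate. The zero column of \<open>Y\<close>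
  makes the rate independent of \<open>p $ j\<close>, which gives the sign of that gradient
  component directly. Equality of derivatives needs a two-sided curve, feasibility is only
  one-sided; the surrogate lies below the objective on both sides, so the two are kept
  apart.\<close>

lemma ctranspose_nth [simp]: "ctranspose A $ i $ j = cnj (A $ j $ i)"
  by (simp add: ctranspose_def)

lemma ctranspose_ctranspose [simp]: "ctranspose (ctranspose A) = A"
  by (simp add: vec_eq_iff)

lemma ctranspose_mult: "ctranspose (A ** B) = ctranspose B ** ctranspose A"
  by (simp add: vec_eq_iff matrix_matrix_mult_def mult.commute)

lemma ctranspose_diff: "ctranspose (A - B) = ctranspose A - ctranspose B"
  by (simp add: vec_eq_iff)

lemma diag_mat_nth: "diag_mat p $ i $ j = (if i = j then complex_of_real (p $ i) else 0)"
  by (simp add: diag_mat_def)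

lemma ctranspose_diag_mat [simp]: "ctranspose (diag_mat p) = diag_mat p"
  by (auto simp: vec_eq_iff diag_mat_nth)

lemma mult_diag_mat_nth: "(A ** diag_mat p) $ i $ j = A $ i $ j * complex_of_real (p $ j)"
  by (simp add: matrix_matrix_mult_def diag_mat_nth if_distrib [of "\<lambda>x. _ * x"] cong: if_cong)

lemma diag_mat_mult_vec_nth: "(diag_mat p *v v) $ i = complex_of_real (p $ i) * v $ i"
  by (simp add: matrix_vector_mult_def diag_mat_nth if_distrib [of "\<lambda>x. x * _"] cong: if_cong)

lemma inner_complex: "inner a b = Re (cnj a * b)" for a b :: complex
  by (simp add: inner_complex_def)

text \<open>The inner product on complex vectors is the real part of the Hermitian one, so
  definiteness and symmetry can be handled with real inner products throughout.\<close>

lemma Re_quad_form: "Re (quad_form A v) = inner v (A *v v)"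
  by (simp add: quad_form_def inner_vec_def inner_complex)

lemma inner_ctranspose: "inner (ctranspose A *v x) y = inner x (A *v y)"
proof -
  have "(\<Sum>i\<in>UNIV. cnj ((ctranspose A *v x) $ i) * y $ i)
      = (\<Sum>i\<in>UNIV. \<Sum>j\<in>UNIV. cnj (x $ j) * A $ j $ i * y $ i)"
    by (simp add: matrix_vector_mult_def sum_distrib_left mult_ac)
  also have "\<dots> = (\<Sum>j\<in>UNIV. \<Sum>i\<in>UNIV. cnj (x $ j) * A $ j $ i * y $ i)"
    by (rule sum.swap)
  also have "\<dots> = (\<Sum>j\<in>UNIV. cnj (x $ j) * (A *v y) $ j)"
    by (simp add: matrix_vector_mult_def sum_distrib_left mult_ac)
  finally show ?thesis
    unfolding inner_vec_def inner_complex Re_sum [symmetric] by simp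
qed

lemma hermitian_iff_inner: "hermitian A \<longleftrightarrow> (\<forall>x y. inner (A *v x) y = inner x (A *v y))"
proof
  assume "\<forall>x y. inner (A *v x) y = inner x (A *v y)"
  then have "ctranspose A *v x = A *v x" for x
    by (metis inner_ctranspose vector_eq_rdot)
  then show "hermitian A"
    unfolding hermitian_def matrix_eq by blast
qed (metis hermitian_def inner_ctranspose)

lemma matrix_diff_ldistrib: "A ** (B - C) = A ** B - A ** C" for A :: "'a::ring_1^'n^'m"
  by (simp add: vec_eq_iff matrix_matrix_mult_def right_diff_distrib sum_subtractf)

lemma matrix_diff_rdistrib: "(B - C) ** A = B ** A - C ** A" for A :: "'a::ring_1^'n^'m"
  by (simp add: vec_eq_iff matrix_matrix_mult_def left_diff_distrib sum_subtractf)

text \<open>Factoring \<open>gram H\<close> turns the quadratic form on the left into a squared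
  norm, and Hermitian symmetry is automatic. In this form the constraint passes to limits and can be
  tested on unit vectors.\<close>

lemma loewner_le_gram_iff:
  "loewner_le (ctranspose X ** gram H ** X) (diag_mat p) \<longleftrightarrow>
     (\<forall>v. (norm ((ctranspose H ** X) *v v))\<^sup>2 \<le> (\<Sum>j\<in>UNIV. p $ j * (cmod (v $ j))\<^sup>2))"
proof -
  have eq: "ctranspose X ** gram H ** X = ctranspose (ctranspose H ** X) ** (ctranspose H ** X)"
    by (simp add: gram_def ctranspose_mult matrix_mul_assoc)
  have "hermitian (diag_mat p - ctranspose X ** gram H ** X)"
    unfolding eq by (simp add: hermitian_def ctranspose_diff ctranspose_mult)
  moreover have "Re (quad_form (diag_mat p - ctranspose X ** gram H ** X) v) =
      (\<Sum>j\<in>UNIV. p $ j * (cmod (v $ j))\<^sup>2) - (norm ((ctranspose H ** X) *v v))\<^sup>2" for v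
  proof -
    have "inner v (diag_mat p *v v) = (\<Sum>j\<in>UNIV. p $ j * (cmod (v $ j))\<^sup>2)"
      unfolding inner_vec_def diag_mat_mult_vec_nth inner_complex_def cmod_power2
      by (simp add: power2_eq_square algebra_simps)
    moreover have "inner v ((ctranspose (ctranspose H ** X) ** (ctranspose H ** X)) *v v)
        = (norm ((ctranspose H ** X) *v v))\<^sup>2"
      using inner_ctranspose [of "ctranspose H ** X" "(ctranspose H ** X) *v v" v]
      by (simp add: matrix_vector_mul_assoc [symmetric] power2_norm_eq_inner inner_commute)
    ultimately show ?thesis
      by (simp add: Re_quad_form eq matrix_vector_mult_diff_rdistrib inner_diff_right)
  qed
  ultimately show ?thesis
    by (simp add: loewner_le_def pos_semidef_def)
qed

lemma pos_semidef_congruence: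
  assumes "pos_semidef A" shows "pos_semidef (ctranspose X ** A ** X)"
proof -
  have "hermitian (ctranspose X ** A ** X)"
    using assms by (simp add: pos_semidef_def hermitian_def ctranspose_mult matrix_mul_assoc)
  moreover have "0 \<le> Re (quad_form (ctranspose X ** A ** X) v)" for v
  proof -
    have "Re (quad_form (ctranspose X ** A ** X) v) = Re (quad_form A (X *v v))"
      unfolding Re_quad_form
      by (metis ctranspose_ctranspose inner_ctranspose matrix_vector_mul_assoc)
    then show ?thesis using assms by (simp add: pos_semidef_def)
  qed
  ultimately show ?thesis by (simp add: pos_semidef_def)
qed

section \<open>Definiteness of the Gram matrix\<close>

lemma Re_quad_form_gram: "Re (quad_form (gram H) v) = (norm (ctranspose H *v v))\<^sup>2"
  by (simp add: Re_quad_form gram_def matrix_vector_mul_assoc [symmetric] power2_norm_eq_inner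
      inner_ctranspose [symmetric])

lemma pos_semidef_gram: "pos_semidef (gram H)"
  using Re_quad_form_gram [of H]
  by (simp add: pos_semidef_def hermitian_def gram_def ctranspose_mult)

text \<open>The conjugated entries of \<open>v\<close> are the coefficients of a vanishing
  combination of the rows of \<open>H\<close>.\<close>

lemma ctranspose_mult_vec_eq_0:
  fixes H :: "complex^'n^'k"
  assumes "rank H = CARD('k)" and "ctranspose H *v v = 0"
  shows "v = 0"
proof -
  have dim: "vec.dim (rows H) = CARD('k)"
    using assms(1) by (simp add: row_rank_def_gen)
  have rows: "rows H = range (\<lambda>i. row i H)"
    by (auto simp: rows_def)
  have fin: "finite (rows H)" by (simp add: rows)
  have card: "card (rows H) \<le> CARD('k)"
    by (simp add: rows card_image_le)
  \<comment> \<open>\<open>rows H\<close> is a set, so its independence alone would not exclude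
    repeated rows; the count makes the indexing injective.\<close>
  have "card (rows H) = CARD('k)"
    using card dim vec.dim_le_card' [OF fin] by linarith
  then have inj: "inj (\<lambda>i. row i H)"
    unfolding rows by (simp add: eq_card_imp_inj_on)
  have ind: "vec.independent (rows H)"
    using vec.card_le_dim_spanning [of "rows H" "rows H"] dim card fin by (simp add: vec.span_superset)
  have "(\<Sum>i\<in>UNIV. cnj (v $ i) *s row i H) = (\<chi> j. cnj ((ctranspose H *v v) $ j))"
    by (simp add: vec_eq_iff matrix_vector_mult_def row_def mult.commute)
  also have "\<dots> = 0" by (simp add: assms(2) vec_eq_iff)
  finally have "(\<Sum>i\<in>UNIV. cnj (v $ i) *s row i H) = 0" .
  moreover have "(\<Sum>i\<in>UNIV. cnj (v $ i) *s row i H)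
      = (\<Sum>r\<in>rows H. cnj (v $ inv (\<lambda>i. row i H) r) *s r)"
    unfolding rows sum.reindex [OF inj] using inv_f_f [OF inj] by simp
  ultimately have "cnj (v $ inv (\<lambda>i. row i H) r) = 0" if "r \<in> rows H" for r
    using vec.independentD [OF ind fin order_refl _ that, of "\<lambda>r. cnj (v $ inv (\<lambda>i. row i H) r)"] by simp
  then have "v $ i = 0" for i
    using inj by (metis (mono_tags, lifting) complex_cnj_zero_iff inv_f_f rangeI rows)
  then show ?thesis by (simp add: vec_eq_iff)
qed

lemma pos_def_gram:
  fixes H :: "complex^'n^'k"
  assumes "rank H = CARD('k)"
  shows "pos_def (gram H)"
  using ctranspose_mult_vec_eq_0 [OF assms] pos_semidef_gram [of H]
  by (auto simp: pos_semidef_def pos_def_def Re_quad_form_gram)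

text \<open>The quadratic form attains a positive minimum on the compact unit sphere, and
  homogeneity does the rest. The constant \<open>m\<close> determines the scaling in the
  construction of the square root.\<close>

lemma pos_def_coercive:
  assumes "pos_def A"
  obtains m where "0 < m" and "\<And>v. m * (norm v)\<^sup>2 \<le> inner v (A *v v)"
proof -
  let ?S = "sphere (0 :: complex^'a) 1"
  have "continuous_on ?S (\<lambda>v. inner v (A *v v))"
    by (intro continuous_intros)
  moreover have "?S \<noteq> {}" by simp
  ultimately obtain w where w: "w \<in> ?S" "\<And>v. v \<in> ?S \<Longrightarrow> inner w (A *v w) \<le> inner v (A *v v)"
    using continuous_attains_inf [OF compact_sphere] by blast
  show thesis
  proof
    have "w \<noteq> 0" using w(1) by auto
    then show "0 < inner w (A *v w)" using assms by (simp add: pos_def_def Re_quad_form)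
    show "inner w (A *v w) * (norm v)\<^sup>2 \<le> inner v (A *v v)" for v
    proof (cases "v = 0")
      case False
      define u where "u = (1 / norm v) *\<^sub>R v"
      have "u \<in> ?S" using False by (simp add: u_def)
      have v: "v = norm v *\<^sub>R u" using False by (simp add: u_def)
      have "inner v (A *v v) = (norm v)\<^sup>2 * inner u (A *v u)"
        by (subst v, subst (2) v) (simp add: linear_cmul [OF matrix_vector_mul_linear] power2_eq_square)
      then show ?thesis using w(2) [OF \<open>u \<in> ?S\<close>] by (simp add: mult.commute mult_right_mono)
    qed simp
  qed
qed

text \<open>
  After scaling, \<open>B = 1 - A\<close> has operator norm below 1, and \<open>T \<mapsto> (B + T\<^sup>2) / 2\<close> is a contraction
  of a ball; its fixed point satisfies \<open>(1 - T)\<^sup>2 = A\<close>.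
\<close>

lemma pos_def_sqrt_exists:
  fixes A :: "complex^'k^'k"
  assumes "pos_def A"
  shows "\<exists>S. pos_def S \<and> S ** S = A"
proof -
  obtain m where m: "0 < m" "\<And>v. m * (norm v)\<^sup>2 \<le> inner v (A *v v)"
    using pos_def_coercive [OF assms] by blast
  have herm: "inner (A *v x) y = inner x (A *v y)" for x y
    using assms by (simp add: pos_def_def hermitian_iff_inner)
  \<comment> \<open>The maximum with \<open>m\<close> ensures \<open>m \<le> M\<close> and
    \<open>0 < M\<close>.\<close>
  define M where "M = max (onorm ((*v) A)) m"
  have M: "norm (A *v v) \<le> M * norm v" for v
  proof -
    have "norm (A *v v) \<le> onorm ((*v) A) * norm v" by (rule onorm) simp
    also have "\<dots> \<le> M * norm v" by (intro mult_right_mono) (simp_all add: M_def)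
    finally show ?thesis .
  qed
  have "m \<le> M" "0 < M" using m(1) by (auto simp: M_def)
  \<comment> \<open>The bound \<open>1 - 2 m / c + M\<^sup>2 / c\<^sup>2\<close> for the squared
    operator norm of \<open>b\<close> is smallest at this \<open>c\<close>, where it equals
    \<open>\<beta>\<^sup>2\<close>.\<close>
  define c where "c = M\<^sup>2 / m"
  have "0 < c" using m(1) \<open>0 < M\<close> by (simp add: c_def)
  define \<beta> where "\<beta> = sqrt (1 - m\<^sup>2 / M\<^sup>2)"
  have mM: "0 < m\<^sup>2 / M\<^sup>2" "m\<^sup>2 / M\<^sup>2 \<le> 1"
    using m(1) \<open>m \<le> M\<close> \<open>0 < M\<close> by (auto simp: power_mono)
  have \<beta>: "0 \<le> \<beta>" "\<beta> < 1"
    using mM by (auto simp: \<beta>_def)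
  define b where "b v = v - (1 / c) *\<^sub>R (A *v v)" for v
  have b_lin: "bounded_linear b"
    unfolding b_def by (intro bounded_linear_intros) simp
  have b_norm: "norm (b v) \<le> \<beta> * norm v" for v
  proof (rule power2_le_imp_le)
    have "(norm (b v))\<^sup>2 = (norm v)\<^sup>2 - 2 / c * inner v (A *v v) + (norm (A *v v))\<^sup>2 / c\<^sup>2"
      unfolding power2_norm_eq_inner b_def
      by (simp add: inner_diff inner_commute power2_eq_square)
    also have "\<dots> \<le> (norm v)\<^sup>2 - 2 / c * (m * (norm v)\<^sup>2) + (M * norm v)\<^sup>2 / c\<^sup>2"
      using \<open>0 < c\<close> m(2) [of v] power_mono [OF M [of v], of 2]
      by (intro add_mono diff_mono mult_left_mono divide_right_mono) auto
    also have "\<dots> = (1 - m\<^sup>2 / M\<^sup>2) * (norm v)\<^sup>2"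
      using m(1) \<open>0 < M\<close> by (simp add: c_def field_simps power2_eq_square)
    also have "\<dots> = (\<beta> * norm v)\<^sup>2"
      using mM by (simp add: \<beta>_def power_mult_distrib)
    finally show "(norm (b v))\<^sup>2 \<le> (\<beta> * norm v)\<^sup>2" .
  qed (simp add: \<beta>)
  define B where "B = Blinfun b"
  have B: "blinfun_apply B = b" unfolding B_def by (simp add: b_lin bounded_linear_Blinfun_apply)
  have norm_B: "norm B \<le> \<beta>"
    using b_norm \<beta> by (intro norm_blinfun_bound) (auto simp: B)
  \<comment> \<open>The smaller root of \<open>\<rho>\<^sup>2 - 2 \<rho> + \<beta> = 0\<close>: the
    ball of this radius is mapped into itself, and \<open>\<rho>\<close> is also the contraction
    factor.\<close>
  define \<rho> where "\<rho> = 1 - sqrt (1 - \<beta>)"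
  have \<rho>: "0 \<le> \<rho>" "\<rho> < 1" "(\<beta> + \<rho>\<^sup>2) / 2 = \<rho>"
    using \<beta> by (auto simp: \<rho>_def power2_diff)
  \<comment> \<open>Bounded linear maps are only real-linear here. Complex homogeneity is a closed
    condition of its own, and it is what makes the fixed point a complex matrix.\<close>
  define Q :: "((complex^'k) \<Rightarrow>\<^sub>L (complex^'k)) set" where
    "Q = {T. norm T \<le> \<rho>} \<inter> {T. \<forall>x y. inner (blinfun_apply T x) y = inner x (blinfun_apply T y)}
       \<inter> {T. \<forall>a x. blinfun_apply T (a *s x) = a *s blinfun_apply T x}"
  define f where "f T = (1/2) *\<^sub>R (B + (T o\<^sub>L T))" for T
  have smult: "((*s) a) = ((*v) (mat a))" for a :: complex
    by (simp add: fun_eq_iff vec_eq_iff matrix_vector_mult_def mat_def if_distrib [of "\<lambda>x. x * _"] cong: if_cong)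
  have cont_smult: "continuous_on UNIV (\<lambda>T. a *s (blinfun_apply T x))" for a :: complex and x :: "complex^'k"
    unfolding smult
    by (intro bounded_linear.continuous_on [OF matrix_vector_mul_bounded_linear] continuous_intros)
  have "closed Q"
    unfolding Q_def
    by (intro closed_Int closed_Collect_all closed_Collect_eq closed_Collect_le continuous_intros cont_smult)
  then have "complete Q" by (simp add: complete_eq_closed)
  have "0 \<in> Q" using \<rho> by (simp add: Q_def)
  have norm_comp: "norm (S o\<^sub>L T) \<le> norm S * norm T" for S T :: "(complex^'k) \<Rightarrow>\<^sub>L (complex^'k)"
    by (rule norm_blinfun_compose)
  have "f T \<in> Q" if "T \<in> Q" for T
  proof -
    have T: "norm T \<le> \<rho>" "\<And>x y. inner (blinfun_apply T x) y = inner x (blinfun_apply T y)"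
      "\<And>a x. blinfun_apply T (a *s x) = a *s blinfun_apply T x"
      using that by (auto simp: Q_def)
    have "norm (f T) \<le> (norm B + norm (T o\<^sub>L T)) / 2"
      unfolding f_def using norm_triangle_ineq [of B "T o\<^sub>L T"] by simp
    also have "norm (T o\<^sub>L T) \<le> \<rho> * \<rho>"
      using norm_comp [of T T] T(1) \<rho> mult_mono [OF T(1) T(1)] by force
    finally have "norm (f T) \<le> \<rho>" using norm_B \<rho>(3) by (simp add: power2_eq_square)
    moreover have "inner (b x) y = inner x (b y)" for x y
      by (simp add: b_def inner_diff herm)
    then have "inner (blinfun_apply (f T) x) y = inner x (blinfun_apply (f T) y)" for x y
      by (simp add: f_def B blinfun.bilinear_simps inner_add T(2))
    moreover have "b (a *s x) = a *s b x" for a x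
      by (simp add: b_def vector_scalar_commute vec_eq_iff scaleR_conv_of_real [where 'a = complex] algebra_simps)
    then have "blinfun_apply (f T) (a *s x) = a *s blinfun_apply (f T) x" for a x
      by (simp add: f_def B blinfun.bilinear_simps T(3))
         (simp add: vec_eq_iff scaleR_conv_of_real [where 'a = complex] algebra_simps)
    ultimately show ?thesis by (simp add: Q_def)
  qed
  moreover have "dist (f S) (f T) \<le> \<rho> * dist S T" if "S \<in> Q" "T \<in> Q" for S T
  proof -
    have "(S o\<^sub>L S) - (T o\<^sub>L T) = (S o\<^sub>L (S - T)) + ((S - T) o\<^sub>L T)"
      by (rule blinfun_eqI) (simp add: blinfun.bilinear_simps)
    then have "norm ((S o\<^sub>L S) - (T o\<^sub>L T)) \<le> norm S * norm (S - T) + norm (S - T) * norm T"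
      using norm_triangle_ineq [of "S o\<^sub>L (S - T)" "(S - T) o\<^sub>L T"] norm_comp [of S "S - T"] norm_comp [of "S - T" T]
      by simp
    also have "\<dots> \<le> \<rho> * norm (S - T) + norm (S - T) * \<rho>"
      using that by (intro add_mono mult_left_mono mult_right_mono) (auto simp: Q_def)
    finally have "norm ((S o\<^sub>L S) - (T o\<^sub>L T)) \<le> 2 * (\<rho> * norm (S - T))" by simp
    moreover have "f S - f T = (1/2) *\<^sub>R ((S o\<^sub>L S) - (T o\<^sub>L T))"
      by (simp add: f_def algebra_simps)
    ultimately show ?thesis by (simp add: dist_norm)
  qed
  ultimately have "\<exists>!T. T \<in> Q \<and> f T = T"
    using \<open>complete Q\<close> \<open>0 \<in> Q\<close> \<rho> by (intro Banach_fix [of Q \<rho> f]) auto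
  then obtain T where "T \<in> Q" "f T = T" by blast
  then have T: "norm T \<le> \<rho>" "\<And>x y. inner (blinfun_apply T x) y = inner x (blinfun_apply T y)"
      "\<And>a x. blinfun_apply T (a *s x) = a *s blinfun_apply T x"
    by (auto simp: Q_def)
  \<comment> \<open>The fixed point satisfies \<open>T\<^sup>2 = 2 T - B\<close>, so
    \<open>g\<close> squares to \<open>c (1 - B) = A\<close>.\<close>
  define g where "g v = sqrt c *\<^sub>R (v - blinfun_apply T v)" for v
  have g_lin: "Vector_Spaces.linear (*s) (*s) g"
    by unfold_locales
       (simp_all add: g_def T(3) blinfun.bilinear_simps algebra_simps,
        simp add: vec_eq_iff scaleR_conv_of_real [where 'a = complex] algebra_simps)
  define S where "S = matrix g"
  have S: "S *v v = g v" for v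
    unfolding S_def by (rule matrix_works [OF g_lin])
  have "hermitian S"
    by (simp add: hermitian_iff_inner S g_def inner_diff T(2))
  moreover have "0 < inner v (S *v v)" if "v \<noteq> 0" for v
  proof -
    have "inner v (blinfun_apply T v) \<le> norm v * norm (blinfun_apply T v)"
      by (rule norm_cauchy_schwarz)
    also have "\<dots> \<le> norm v * (\<rho> * norm v)"
      using norm_blinfun [of T v] mult_right_mono [OF T(1) norm_ge_zero, of v]
      by (intro mult_left_mono) auto
    also have "\<dots> < inner v v"
      using \<rho> that by (simp add: power2_norm_eq_inner [symmetric] power2_eq_square)
    finally show ?thesis using \<open>0 < c\<close> by (simp add: S g_def inner_diff)
  qed
  moreover have "S ** S = A"
  proof -
    have TT: "blinfun_apply T (blinfun_apply T v) = 2 *\<^sub>R blinfun_apply T v - b v" for v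
    proof -
      have "2 *\<^sub>R blinfun_apply (f T) v = b v + blinfun_apply T (blinfun_apply T v)"
        by (simp add: f_def B blinfun.bilinear_simps)
      then show ?thesis using \<open>f T = T\<close> by (simp add: algebra_simps)
    qed
    have "(S ** S) *v v = A *v v" for v
    proof -
      have "(S ** S) *v v = g (g v)"
        by (simp add: matrix_vector_mul_assoc [symmetric] S)
      also have "\<dots> = c *\<^sub>R (v - 2 *\<^sub>R blinfun_apply T v + blinfun_apply T (blinfun_apply T v))"
        using \<open>0 < c\<close> by (simp add: g_def blinfun.bilinear_simps algebra_simps scaleR_2)
      also have "\<dots> = A *v v"
        using \<open>0 < c\<close> by (simp add: TT b_def)
      finally show ?thesis .
    qed
    then show ?thesis unfolding matrix_eq by blast
  qed
  ultimately show ?thesis by (auto simp: pos_def_def Re_quad_form)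
qed

lemma mult_axis_nth: "(M *v axis j 1) $ i = M $ i $ j" for M :: "complex^'k^'m"
  by (simp add: matrix_vector_mult_def axis_def if_distrib [of "\<lambda>x. _ * x"] cong: if_cong)

lemma inner_matrix_columns:
  fixes A B :: "complex^'k^'m"
  shows "inner A B = (\<Sum>j\<in>UNIV. inner (A *v axis j 1) (B *v axis j 1))"
  unfolding inner_vec_def mult_axis_nth by (rule sum.swap)

lemma inner_ctranspose_both: "inner (ctranspose A) (ctranspose B) = inner A B"
  unfolding inner_vec_def by simp (subst sum.swap, simp add: inner_complex_def)

text \<open>With \<open>D = S - T\<close>, \<open>S ** D + D ** T = 0\<close>; pairing with \<open>D\<close> forces \<open>D = 0\<close>.\<close>

lemma pos_def_sqrt_unique:
  fixes S T :: "complex^'k^'k"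
  assumes "pos_def S" "pos_def T" "S ** S = T ** T"
  shows "S = T"
proof (rule ccontr)
  assume "S \<noteq> T"
  define D where "D = S - T"
  have "S ** D + D ** T = 0"
    by (simp add: D_def matrix_diff_ldistrib matrix_diff_rdistrib assms(3))
  have herm: "ctranspose D = D"
    using assms by (simp add: D_def pos_def_def hermitian_def ctranspose_diff)
  \<comment> \<open>Column by column, the pairing is the quadratic form of \<open>Q\<close> at the
    columns of \<open>D\<close>.\<close>
  have quad: "0 \<le> inner D (Q ** D)" "inner D (Q ** D) = 0 \<Longrightarrow> D = 0" if "pos_def Q" for Q
  proof -
    have q: "0 \<le> inner (D *v v) (Q *v (D *v v))" for v
      using that unfolding pos_def_def Re_quad_form
      by (cases "D *v v = 0") (auto intro: less_imp_le)
    have eq: "inner D (Q ** D) = (\<Sum>j\<in>UNIV. inner (D *v axis j 1) (Q *v (D *v axis j 1)))"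
      by (subst inner_matrix_columns) (simp add: matrix_vector_mul_assoc)
    show "0 \<le> inner D (Q ** D)"
      unfolding eq by (intro sum_nonneg q)
    assume "inner D (Q ** D) = 0"
    then have "inner (D *v axis j 1) (Q *v (D *v axis j 1)) = 0" for j
      unfolding eq using q by (simp add: sum_nonneg_eq_0_iff)
    then have "D *v axis j 1 = 0" for j
      using that unfolding pos_def_def Re_quad_form by (metis less_irrefl)
    then have "inner D D = 0" by (subst inner_matrix_columns) simp
    then show "D = 0" by simp
  qed
  \<comment> \<open>Conjugate transposition of both arguments moves \<open>T\<close> to the left,
    since \<open>D\<close> and \<open>T\<close> are Hermitian.\<close>
  have "inner D (D ** T) = inner D (T ** D)"
    using inner_ctranspose_both [of D "D ** T"] assms(2) herm
    by (simp add: ctranspose_mult pos_def_def hermitian_def)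
  then have "inner D (S ** D) + inner D (T ** D) = 0"
    using \<open>S ** D + D ** T = 0\<close> by (metis inner_add_right inner_zero_right)
  then have "D = 0" using quad [OF assms(1)] quad [OF assms(2)] by linarith
  then show False using \<open>S \<noteq> T\<close> by (simp add: D_def)
qed

section \<open>The positive definite square root and the substitution of precoders\<close>

text \<open>\<open>herm_sqrt\<close> is a definite description, so both existence and uniqueness
  enter.\<close>

lemma herm_sqrt:
  assumes "pos_def A"
  shows "pos_def (herm_sqrt A)" and "herm_sqrt A ** herm_sqrt A = A"
proof -
  have "\<exists>!S. pos_def S \<and> S ** S = A"
    using pos_def_sqrt_exists [OF assms] pos_def_sqrt_unique by blast
  from theI' [OF this] show "pos_def (herm_sqrt A)" "herm_sqrt A ** herm_sqrt A = A"
    by (simp_all add: herm_sqrt_def)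
qed

lemma herm_inv_sqrt:
  fixes A :: "complex^'k^'k"
  assumes "pos_def A"
  shows "herm_sqrt A ** herm_inv_sqrt A = mat 1" and "herm_inv_sqrt A ** herm_sqrt A = mat 1"
proof -
  have "v = 0" if "herm_sqrt A *v v = 0" for v
    using herm_sqrt(1) [OF assms] that unfolding pos_def_def Re_quad_form
    by (metis inner_zero_right less_irrefl)
  then have "\<exists>B. B ** herm_sqrt A = mat 1"
    by (simp add: matrix_left_invertible_ker)
  \<comment> \<open>\<open>matrix_inv\<close> chooses a two-sided inverse, so one must be known to
    exist.\<close>
  then have "\<exists>B. herm_sqrt A ** B = mat 1 \<and> B ** herm_sqrt A = mat 1"
    using matrix_left_right_inverse by blast
  then have "herm_sqrt A ** matrix_inv (herm_sqrt A) = mat 1 \<and> matrix_inv (herm_sqrt A) ** herm_sqrt A = mat 1"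
    unfolding matrix_inv_def by (rule someI_ex)
  then show "herm_sqrt A ** herm_inv_sqrt A = mat 1" "herm_inv_sqrt A ** herm_sqrt A = mat 1"
    by (simp_all add: herm_inv_sqrt_def)
qed

text \<open>Both norms square to the quadratic form of \<open>gram H\<close>. Hence the invertible
  square root can replace the rectangular \<open>ctranspose H\<close>.\<close>

lemma norm_herm_sqrt_gram:
  assumes "pos_def (gram H)"
  shows "norm (herm_sqrt (gram H) *v v) = norm (ctranspose H *v v)"
proof -
  let ?S = "herm_sqrt (gram H)"
  have "inner (?S *v v) (?S *v v) = inner v (gram H *v v)"
    using herm_sqrt [OF assms]
    by (metis hermitian_iff_inner matrix_vector_mul_assoc pos_def_def)
  also have "\<dots> = inner (ctranspose H *v v) (ctranspose H *v v)"
    by (simp add: gram_def inner_ctranspose flip: matrix_vector_mul_assoc)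
  finally show ?thesis by (simp add: norm_eq_sqrt_inner)
qed

section \<open>The spectral norm and the substitution between \<open>X\<close> and
  \<open>Y\<close>\<close>

lemma norm_le_spectral_norm: "norm (A *v v) \<le> spectral_norm A * norm v"
  unfolding spectral_norm_def by (rule onorm) simp

lemma scaleR_mult_vec: "(c *\<^sub>R A) *v v = c *\<^sub>R (A *v v)" for A :: "complex^'n^'m"
  by (simp add: vec_eq_iff matrix_vector_mult_def scaleR_sum_right)

lemma spectral_norm_scaleR: "spectral_norm (c *\<^sub>R A) = \<bar>c\<bar> * spectral_norm A"
  unfolding spectral_norm_def scaleR_mult_vec by (rule onorm_scaleR) simp

lemma spectral_norm_triangle: "spectral_norm (A + B) \<le> spectral_norm A + spectral_norm B"
  unfolding spectral_norm_def matrix_vector_mult_add_rdistrib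
  by (rule onorm_triangle) simp_all

lemma spectral_norm_nonneg: "0 \<le> spectral_norm A"
  unfolding spectral_norm_def by (rule onorm_pos_le) simp

lemma spectral_norm_eq_0: "spectral_norm A = 0 \<Longrightarrow> A = 0"
  unfolding spectral_norm_def by (simp add: onorm_eq_0 matrix_eq)

text \<open>The matrix \<open>X\<close> of (L) that yields the same precoder as
  \<open>(Y, p)\<close> in (T).\<close>

definition lift_T :: "complex^'n^'k \<Rightarrow> complex^'k^'k \<Rightarrow> real^'k \<Rightarrow> complex^'k^'k" where
  "lift_T H Y p = herm_inv_sqrt (gram H) ** Y ** diag_mat (sqrt_vec p)"

lemma ctranspose_mult_lift_T: "ctranspose H ** lift_T H Y p = precoder_T H Y p"
  by (simp add: lift_T_def precoder_T_def matrix_mul_assoc)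

lemma mult_precoder_T: "H ** precoder_T H Y p = gram H ** lift_T H Y p"
  by (simp add: lift_T_def precoder_T_def gram_def matrix_mul_assoc)

lemma herm_sqrt_mult_lift_T:
  assumes "pos_def (gram H)"
  shows "herm_sqrt (gram H) ** lift_T H Y p = Y ** diag_mat (sqrt_vec p)"
  by (simp add: lift_T_def matrix_mul_assoc herm_inv_sqrt [OF assms])

lemma gram_mult_lift_T:
  assumes "pos_def (gram H)"
  shows "gram H ** lift_T H Y p = herm_sqrt (gram H) ** Y ** diag_mat (sqrt_vec p)"
  using herm_sqrt_mult_lift_T [OF assms] herm_sqrt(2) [OF assms]
  by (metis matrix_mul_assoc)

lemma norm_vec_power2: "(norm v)\<^sup>2 = (\<Sum>j\<in>UNIV. (cmod (v $ j))\<^sup>2)" for v :: "complex^'k"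
  unfolding power2_norm_eq_inner inner_vec_def ..

text \<open>The root of \<open>gram H\<close> cancels its inverse, leaving \<open>Y\<close> applied
  to a vector whose squared norm is the quadratic form on the right.\<close>

lemma loewner_le_lift_T:
  fixes H :: "complex^'n^'k"
  assumes "pos_def (gram H)" and "spectral_norm Y \<le> 1" and "\<And>k. 0 \<le> p $ k"
  shows "loewner_le (ctranspose (lift_T H Y p) ** gram H ** lift_T H Y p) (diag_mat p)"
  unfolding loewner_le_gram_iff
proof
  fix v :: "complex^'k"
  let ?w = "diag_mat (sqrt_vec p) *v v"
  have "norm ((ctranspose H ** lift_T H Y p) *v v) = norm (herm_sqrt (gram H) *v (lift_T H Y p *v v))"
    by (simp add: norm_herm_sqrt_gram [OF assms(1)] flip: matrix_vector_mul_assoc)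
  also have "\<dots> = norm (Y *v ?w)"
    by (simp add: matrix_vector_mul_assoc herm_sqrt_mult_lift_T [OF assms(1)])
  also have "\<dots> \<le> norm ?w"
    using norm_le_spectral_norm [of Y ?w] mult_right_mono [OF assms(2) norm_ge_zero, of ?w] by simp
  finally have "(norm ((ctranspose H ** lift_T H Y p) *v v))\<^sup>2 \<le> (norm ?w)\<^sup>2"
    by (simp add: power_mono)
  also have "\<dots> = (\<Sum>j\<in>UNIV. p $ j * (cmod (v $ j))\<^sup>2)"
    by (simp add: norm_vec_power2 diag_mat_mult_vec_nth sqrt_vec_def norm_mult power_mult_distrib assms(3))
  finally show "(norm ((ctranspose H ** lift_T H Y p) *v v))\<^sup>2 \<le> (\<Sum>j\<in>UNIV. p $ j * (cmod (v $ j))\<^sup>2)" .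
qed

lemma loewner_le_gram_column:
  assumes "loewner_le (ctranspose X ** gram H ** X) (diag_mat p)"
  shows "(norm ((ctranspose H ** X) *v axis j 1))\<^sup>2 \<le> p $ j"
proof -
  have "(\<Sum>i\<in>UNIV. p $ i * (cmod (axis j 1 $ i))\<^sup>2) = (\<Sum>i\<in>UNIV. if i = j then p $ i else 0)"
    by (rule sum.cong) (auto simp: axis_def)
  then show ?thesis
    using assms [unfolded loewner_le_gram_iff, rule_format, of "axis j 1"] by simp
qed

lemma loewner_le_gram_nonneg:
  "loewner_le (ctranspose X ** gram H ** X) (diag_mat p) \<Longrightarrow> 0 \<le> p $ j"
  using loewner_le_gram_column [of X H p j] by (meson order_trans zero_le_power2)

text \<open>
  Where \<open>p $ j = 0\<close> the Loewner constraint annihilates the \<open>j\<close>-th column of \<open>X\<close>, and the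
  \<open>j\<close>-th column of \<open>Y\<close> may be chosen to be \<open>0\<close>.
\<close>

lemma loewner_le_gram_obtain_contraction:
  fixes H :: "complex^'n^'k"
  assumes pd: "pos_def (gram H)" and le: "loewner_le (ctranspose X ** gram H ** X) (diag_mat p)"
  obtains Y where "X = lift_T H Y p" and "spectral_norm Y \<le> 1"
    and "\<And>i j. p $ j = 0 \<Longrightarrow> Y $ i $ j = 0"
proof
  define Z where "Z = herm_sqrt (gram H) ** X"
  \<comment> \<open>Division by zero gives \<open>d $ j = 0\<close> where \<open>p $ j = 0\<close>;
    nothing is lost, as the \<open>j\<close>-th column of \<open>Z\<close> vanishes there.\<close>
  define d where "d = (\<chi> j. 1 / sqrt (p $ j))"
  define Y where "Y = Z ** diag_mat d"
  have p: "0 \<le> p $ j" for j using loewner_le_gram_nonneg [OF le] .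
  have Zv: "norm (Z *v v) = norm ((ctranspose H ** X) *v v)" for v
    by (simp add: Z_def norm_herm_sqrt_gram [OF pd] flip: matrix_vector_mul_assoc)
  have Z0: "Z $ i $ j = 0" if "p $ j = 0" for i j
  proof -
    have "norm (Z *v axis j 1) = 0"
      using loewner_le_gram_column [OF le, of j] by (simp add: Zv that)
    then show ?thesis by (metis mult_axis_nth norm_eq_zero zero_index)
  qed
  then show "Y $ i $ j = 0" if "p $ j = 0" for i j
    by (simp add: Y_def mult_diag_mat_nth that)
  have "Z $ i $ j * complex_of_real (d $ j) * complex_of_real (sqrt (p $ j)) = Z $ i $ j" for i j
    using Z0 [of j i] by (cases "p $ j = 0") (simp_all add: d_def)
  then have "Y ** diag_mat (sqrt_vec p) = Z"
    by (simp add: vec_eq_iff Y_def mult_diag_mat_nth sqrt_vec_def)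
  then have "lift_T H Y p = herm_inv_sqrt (gram H) ** Z"
    by (simp add: lift_T_def flip: matrix_mul_assoc)
  then show "X = lift_T H Y p"
    by (simp add: Z_def matrix_mul_assoc herm_inv_sqrt [OF pd])
  show "spectral_norm Y \<le> 1"
    unfolding spectral_norm_def
  proof (rule onorm_le)
    fix v
    let ?w = "diag_mat d *v v"
    have "(norm (Y *v v))\<^sup>2 = (norm ((ctranspose H ** X) *v ?w))\<^sup>2"
      by (simp add: Y_def Zv flip: matrix_vector_mul_assoc)
    also have "\<dots> \<le> (\<Sum>j\<in>UNIV. p $ j * (cmod (?w $ j))\<^sup>2)"
      using le unfolding loewner_le_gram_iff by blast
    also have "\<dots> \<le> (\<Sum>j\<in>UNIV. (cmod (v $ j))\<^sup>2)"
      using p by (intro sum_mono)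
        (auto simp: diag_mat_mult_vec_nth d_def norm_mult norm_divide power_mult_distrib power_divide)
    finally have "(norm (Y *v v))\<^sup>2 \<le> (norm v)\<^sup>2" by (simp add: norm_vec_power2)
    then show "norm (Y *v v) \<le> 1 * norm v" using power2_le_imp_le [of "norm (Y *v v)" "norm v"] by simp
  qed
qed

text \<open>At a unit vector \<open>v\<close> where \<open>norm (Y *v v)\<close> is maximal, the
  functional \<open>Z \<mapsto> inner (sgn (Y *v v)) (Z *v v)\<close> supports the norm. This serves
  the case of a zero gradient, where the multiplier vanishes but some subgradient must still be
  exhibited.\<close>

lemma subgradient_spectral_norm_exists:
  fixes Y :: "complex^'k^'k"
  shows "\<exists>V. subgradient spectral_norm Y V"
proof -
  have "continuous_on (sphere 0 1) (\<lambda>v. norm (Y *v v))"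
    by (intro continuous_intros)
  then obtain v where v: "norm v = 1" "\<And>w. norm w = 1 \<Longrightarrow> norm (Y *v w) \<le> norm (Y *v v)"
    using continuous_attains_sup [OF compact_sphere, of 0 1 "\<lambda>v. norm (Y *v v)"]
    by (auto simp: sphere_eq_empty)
  have Yv: "spectral_norm Y \<le> norm (Y *v v)"
    unfolding spectral_norm_def
  proof (rule onorm_le)
    fix w
    show "norm (Y *v w) \<le> norm (Y *v v) * norm w"
    proof (cases "w = 0")
      case False
      then have "norm (Y *v ((1 / norm w) *\<^sub>R w)) \<le> norm (Y *v v)"
        by (intro v(2)) simp
      then show ?thesis using False by (simp add: linear_cmul [OF matrix_vector_mul_linear] field_simps)
    qed simp
  qed
  \<comment> \<open>The matrix representing the functional; \<open>sgn 0 = 0\<close> covers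
    \<open>Y = 0\<close>.\<close>
  define V where "V = adjoint (\<lambda>Z. inner (sgn (Y *v v)) (Z *v v)) 1"
  have "linear (\<lambda>Z :: complex^'k^'k. inner (sgn (Y *v v)) (Z *v v))"
    by (rule linearI) (simp_all add: matrix_vector_mult_add_rdistrib inner_add_right scaleR_mult_vec)
  then have V: "inner V Z = inner (sgn (Y *v v)) (Z *v v)" for Z
    using adjoint_works [of "\<lambda>Z. inner (sgn (Y *v v)) (Z *v v)" Z 1] by (simp add: V_def inner_commute)
  have "inner V Y = norm (Y *v v)"
    by (cases "Y *v v = 0")
       (simp_all add: V sgn_div_norm inner_commute power2_norm_eq_inner [symmetric] power2_eq_square)
  moreover have "inner V Z \<le> spectral_norm Z" for Z
  proof -
    have "inner V Z \<le> norm (sgn (Y *v v)) * norm (Z *v v)"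
      unfolding V by (rule norm_cauchy_schwarz)
    also have "\<dots> \<le> norm (Z *v v)" by (simp add: norm_sgn)
    also have "\<dots> \<le> spectral_norm Z" using norm_le_spectral_norm [of Z v] v(1) by simp
    finally show ?thesis .
  qed
  ultimately have "spectral_norm Y + inner V (Z - Y) \<le> spectral_norm Z" for Z
    unfolding inner_diff_right using Yv by (smt (verit))
  then have "subgradient spectral_norm Y V" by (simp add: subgradient_def)
  then show ?thesis ..
qed

text \<open>For \<open>G \<noteq> 0\<close>, \<open>Y\<close> maximizes the functional of
  \<open>G\<close> over the unit ball, so \<open>l = inner G Y\<close> is the dual norm of
  \<open>G\<close>. It is positive, \<open>Y\<close> lies on the unit sphere, and
  \<open>G / l\<close> is a subgradient there.\<close>

lemma spectral_ball_stationary: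
  fixes Y G :: "complex^'k^'k"
  assumes Y: "spectral_norm Y \<le> 1"
    and opt: "\<And>Z. spectral_norm Z \<le> 1 \<Longrightarrow> inner G (Z - Y) \<le> 0"
  obtains l V where "0 \<le> l" and "subgradient spectral_norm Y V" and "G = l *\<^sub>R V"
    and "l * (spectral_norm Y - 1) = 0"
proof (cases "G = 0")
  case True
  then show thesis
    using subgradient_spectral_norm_exists [of Y] that [of 0] by auto
next
  case False
  define l where "l = inner G Y"
  \<comment> \<open>Normalizing \<open>Z\<close> extends the inequality from the ball to all
    matrices.\<close>
  have opt': "inner G Z \<le> spectral_norm Z * l" for Z
  proof (cases "Z = 0")
    case False
    then have "0 < spectral_norm Z"
      using spectral_norm_nonneg [of Z] spectral_norm_eq_0 [of Z] by linarith
    then show ?thesis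
      using opt [of "(1 / spectral_norm Z) *\<^sub>R Z"]
      by (simp add: spectral_norm_scaleR inner_diff_right l_def field_simps)
  qed (simp add: spectral_norm_def onorm_zero)
  have "0 < inner G G" using False by simp
  then have "0 < l"
    using opt' [of G] spectral_norm_nonneg [of G] by (smt (verit) mult_nonneg_nonpos)
  have "l \<le> spectral_norm Y * l" using opt' [of Y] unfolding l_def .
  then have "1 \<le> spectral_norm Y"
    using mult_strict_right_mono [OF _ \<open>0 < l\<close>, of "spectral_norm Y" 1] by linarith
  then have nY: "spectral_norm Y = 1" using Y by simp
  show thesis
  proof
    show "0 \<le> l" "G = l *\<^sub>R ((1 / l) *\<^sub>R G)" "l * (spectral_norm Y - 1) = 0"
      using \<open>0 < l\<close> nY by simp_all
    show "subgradient spectral_norm Y ((1 / l) *\<^sub>R G)"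
      unfolding subgradient_def
    proof
      fix Z
      have "inner G Z / l \<le> spectral_norm Z"
        using opt' [of Z] \<open>0 < l\<close> by (simp add: pos_divide_le_eq)
      moreover have "inner ((1 / l) *\<^sub>R G) (Z - Y) = (inner G Z - l) / l"
        unfolding l_def by (simp add: inner_diff_right diff_divide_distrib)
      moreover have "(inner G Z - l) / l = inner G Z / l - 1"
        using \<open>0 < l\<close> by (simp add: diff_divide_distrib)
      ultimately show "spectral_norm Y + inner ((1 / l) *\<^sub>R G) (Z - Y) \<le> spectral_norm Z"
        unfolding nY by linarith
    qed
  qed
qed

section \<open>The rate and its minorizer\<close>

definition interference :: "system \<Rightarrow> complex^'k^'k \<Rightarrow> 'k \<Rightarrow> real" where
  "interference s C k = (alpha_q s)\<^sup>2 * (\<Sum>j\<in>UNIV - {k}. (cmod (C $ k $ j))\<^sup>2)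
     + alpha_q s * beta_q s * (\<Sum>j\<in>UNIV. (cmod (C $ k $ j))\<^sup>2) + noise_var s"

lemma rate_interference:
  "rate s C = (\<Sum>k\<in>UNIV. log 2 (1 + (alpha_q s)\<^sup>2 * (cmod (C $ k $ k))\<^sup>2 / interference s C k))"
  by (simp add: rate_def interference_def)

lemma alpha_q_pos: "valid_system s \<Longrightarrow> 0 < alpha_q s"
  by (simp add: valid_system_def alpha_q_def)

lemma interference_pos: "valid_system s \<Longrightarrow> 0 < interference s C k"
  using alpha_q_pos [of s] unfolding interference_def valid_system_def
  by (intro add_nonneg_pos add_nonneg_nonneg mult_nonneg_nonneg sum_nonneg) auto

lemma rate_nonneg: "valid_system s \<Longrightarrow> 0 \<le> rate s C"
  unfolding rate_interference using interference_pos [of s C]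
  by (intro sum_nonneg zero_le_log_cancel_iff [THEN iffD2])
    (auto simp: less_imp_le intro: add_pos_nonneg)

text \<open>The quantization noise is proportional to the signal, so the rate is bounded for any power.\<close>

lemma rate_le:
  fixes C :: "complex^'k^'k"
  assumes "valid_system s"
  shows "rate s C \<le> CARD('k) * log 2 (1 + alpha_q s / beta_q s)"
proof -
  have ab: "0 < alpha_q s" "0 < beta_q s"
    using assms alpha_q_pos by (auto simp: valid_system_def)
  have "(alpha_q s)\<^sup>2 * (cmod (C $ k $ k))\<^sup>2 / interference s C k \<le> alpha_q s / beta_q s" for k
  proof -
    have "alpha_q s * beta_q s * (cmod (C $ k $ k))\<^sup>2 \<le> alpha_q s * beta_q s * (\<Sum>j\<in>UNIV. (cmod (C $ k $ j))\<^sup>2)"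
      using ab member_le_sum [of k UNIV "\<lambda>j. (cmod (C $ k $ j))\<^sup>2"] by (intro mult_left_mono) auto
    also have "\<dots> \<le> interference s C k"
      using assms ab by (simp add: interference_def valid_system_def sum_nonneg)
    finally have "alpha_q s * (alpha_q s * beta_q s * (cmod (C $ k $ k))\<^sup>2) \<le> alpha_q s * interference s C k"
      using ab by (intro mult_left_mono) auto
    then show ?thesis
      using ab interference_pos [OF assms, of C k] by (simp add: field_simps power2_eq_square)
  qed
  then have "log 2 (1 + (alpha_q s)\<^sup>2 * (cmod (C $ k $ k))\<^sup>2 / interference s C k) \<le> log 2 (1 + alpha_q s / beta_q s)" for k
    using interference_pos [OF assms, of C k] by (intro log_mono) (auto simp: add_pos_nonneg)
  then show ?thesis
    unfolding rate_interference
    using sum_mono [of UNIV "\<lambda>k. log 2 (1 + (alpha_q s)\<^sup>2 * (cmod (C $ k $ k))\<^sup>2 / interference s C k)"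
        "\<lambda>_. log 2 (1 + alpha_q s / beta_q s)"] by simp
qed

text \<open>As \<open>alpha_q s + beta_q s = 1\<close>, the factors combine to
  \<open>alpha_q\<^sup>2 + alpha_q beta_q = alpha_q\<close>. The result is the denominator in
  \<open>mmse_receiver\<close>.\<close>

lemma signal_plus_interference:
  "(alpha_q s * cmod (C $ k $ k))\<^sup>2 + interference s C k =
     alpha_q s * (\<Sum>j\<in>UNIV. (cmod (C $ k $ j))\<^sup>2) + noise_var s"
proof -
  have "(\<Sum>j\<in>UNIV. (cmod (C $ k $ j))\<^sup>2) = (cmod (C $ k $ k))\<^sup>2 + (\<Sum>j\<in>UNIV - {k}. (cmod (C $ k $ j))\<^sup>2)"
    by (rule sum.remove) auto
  then show ?thesis
    by (simp add: interference_def alpha_q_def power2_eq_square algebra_simps)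
qed

lemma mse_interference:
  "mse s C u k = (cmod (1 - u $ k * (complex_of_real (alpha_q s) * C $ k $ k)))\<^sup>2 + (cmod (u $ k))\<^sup>2 * interference s C k"
  by (simp add: mse_def interference_def algebra_simps)

text \<open>Completing the square in \<open>u\<close>: the minimum \<open>n / d\<close> is attained
  at \<open>cnj a / d\<close>, which is the receiver chosen by the scheme.\<close>

lemma cmod_mse_expand:
  fixes u a :: complex and n :: real
  assumes "0 < n"
  defines "d \<equiv> (cmod a)\<^sup>2 + n"
  shows "(cmod (1 - u * a))\<^sup>2 + (cmod u)\<^sup>2 * n = d * (cmod (u - cnj a / of_real d))\<^sup>2 + n / d"
proof -
  have d: "0 < d" using assms by (simp add: add_nonneg_pos)
  have n: "n = d - (cmod a)\<^sup>2" by (simp add: d_def)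
  have "d\<^sup>2 * (cmod (u - cnj a / of_real d))\<^sup>2 = (cmod (of_real d * u - cnj a))\<^sup>2"
  proof -
    have "of_real d * u - cnj a = of_real d * (u - cnj a / of_real d)"
      using d by (simp add: algebra_simps)
    then show ?thesis using d by (simp add: norm_mult power_mult_distrib)
  qed
  moreover have "(cmod (of_real d * u - cnj a))\<^sup>2 + n = d * ((cmod (1 - u * a))\<^sup>2 + (cmod u)\<^sup>2 * n)"
    unfolding n cmod_power2 by simp (simp add: power2_eq_square algebra_simps)
  ultimately have "d * ((cmod (1 - u * a))\<^sup>2 + (cmod u)\<^sup>2 * n) = d * (d * (cmod (u - cnj a / of_real d))\<^sup>2 + n / d)"
    using d by (simp add: power2_eq_square algebra_simps)
  then show ?thesis using d by simp
qed

lemma mse_ge: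
  assumes "valid_system s"
  shows "interference s C k / ((alpha_q s * cmod (C $ k $ k))\<^sup>2 + interference s C k) \<le> mse s C u k"
  using cmod_mse_expand [OF interference_pos [OF assms, of C k], of "u $ k" "complex_of_real (alpha_q s) * C $ k $ k"]
    interference_pos [OF assms, of C k] alpha_q_pos [OF assms]
  by (simp add: mse_interference norm_mult add_nonneg_pos less_imp_le)

lemma mse_mmse_receiver:
  assumes "valid_system s"
  shows "mse s C (mmse_receiver s C) k = interference s C k / ((alpha_q s * cmod (C $ k $ k))\<^sup>2 + interference s C k)"
proof -
  have "mmse_receiver s C $ k = cnj (complex_of_real (alpha_q s) * C $ k $ k) /
      complex_of_real ((cmod (complex_of_real (alpha_q s) * C $ k $ k))\<^sup>2 + interference s C k)"
    using alpha_q_pos [OF assms] by (simp add: mmse_receiver_def norm_mult signal_plus_interference)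
  then show ?thesis
    unfolding mse_interference
    by (subst cmod_mse_expand [OF interference_pos [OF assms]])
       (use alpha_q_pos [OF assms] in \<open>simp add: norm_mult\<close>)
qed

lemma mse_pos: "valid_system s \<Longrightarrow> 0 < mse s C u k"
  using mse_ge [of s C k u] interference_pos [of s C k]
  by (meson add_nonneg_pos divide_pos_pos less_le_trans zero_le_power2)

text \<open>The least error is the reciprocal of one plus the ratio of signal to interference and
  noise.\<close>

lemma rate_eq_mse:
  assumes "valid_system s"
  shows "rate s C = 1 / ln 2 * (\<Sum>k\<in>UNIV. ln (1 / mse s C (mmse_receiver s C) k))"
  using interference_pos [OF assms, of C]
  by (simp add: rate_interference mse_mmse_receiver [OF assms] sum_divide_distrib log_def add_divide_distrib power_mult_distrib less_imp_neq [symmetric] add.commute)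

lemma rate_minorizer_touches:
  assumes "valid_system s"
  shows "rate_minorizer s Hb Xn Xn = rate s (Hb ** Xn)"
  using mse_pos [OF assms, of "Hb ** Xn" "mmse_receiver s (Hb ** Xn)"]
  by (simp add: rate_minorizer_def Let_def rate_eq_mse [OF assms] less_imp_neq [symmetric])

text \<open>Two inequalities are chained: the receiver frozen at \<open>Xn\<close> has at least the
  minimal error at \<open>X\<close>, and \<open>ln\<close> lies below its tangent at
  \<open>1\<close>.\<close>

lemma rate_minorizer_le:
  assumes "valid_system s"
  shows "rate_minorizer s Hb Xn X \<le> rate s (Hb ** X)"
proof -
  let ?u = "mmse_receiver s (Hb ** Xn)"
  have "ln (1 / mse s (Hb ** Xn) ?u k) + 1 - 1 / mse s (Hb ** Xn) ?u k * mse s (Hb ** X) ?u k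
      \<le> ln (1 / mse s (Hb ** X) (mmse_receiver s (Hb ** X)) k)" for k
  proof -
    define w where "w = 1 / mse s (Hb ** Xn) ?u k"
    define e where "e = mse s (Hb ** X) ?u k"
    define e' where "e' = mse s (Hb ** X) (mmse_receiver s (Hb ** X)) k"
    have pos: "0 < w" "0 < e" "0 < e'"
      using mse_pos [OF assms] by (auto simp: w_def e_def e'_def)
    have "e' \<le> e"
      unfolding e_def e'_def mse_mmse_receiver [OF assms] by (rule mse_ge [OF assms])
    then have "ln e' \<le> ln e" using pos by simp
    moreover have "ln (w * e) \<le> w * e - 1" using pos by (intro ln_le_minus_one) simp
    moreover have "ln (1 / e') = - ln e'" "ln (w * e) = ln w + ln e"
      using pos by (simp_all add: ln_mult ln_div)
    ultimately show ?thesis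
      unfolding w_def [symmetric] e_def [symmetric] e'_def [symmetric] by linarith
  qed
  then show ?thesis
    unfolding rate_minorizer_def Let_def rate_eq_mse [OF assms]
    by (intro mult_left_mono sum_mono) auto
qed

section \<open>Continuity of the rate and of its minorizer\<close>

lemma tendsto_interference:
  assumes "(C \<longlongrightarrow> C') F"
  shows "((\<lambda>n. interference s (C n) k) \<longlongrightarrow> interference s C' k) F"
  unfolding interference_def by (intro tendsto_intros assms)

lemma tendsto_matrix_mult_left:
  fixes A :: "complex^'n^'m" and X :: "'a \<Rightarrow> complex^'k^'n"
  assumes "(X \<longlongrightarrow> X') F"
  shows "((\<lambda>n. A ** X n) \<longlongrightarrow> A ** X') F"
  unfolding matrix_matrix_mult_def by (intro tendsto_vec_lambda tendsto_intros assms)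

lemma tendsto_rate:
  assumes "valid_system s" and "(C \<longlongrightarrow> C') F"
  shows "((\<lambda>n. rate s (C n)) \<longlongrightarrow> rate s C') F"
proof -
  have "0 < 1 + (alpha_q s)\<^sup>2 * (cmod (C' $ k $ k))\<^sup>2 / interference s C' k" for k
    using interference_pos [OF assms(1), of C' k] by (intro add_pos_nonneg) auto
  then show ?thesis
    unfolding rate_interference log_def
    using interference_pos [OF assms(1), of C'] 
    by (intro tendsto_intros assms(2) tendsto_interference) (auto simp: less_imp_neq [symmetric])
qed

lemma tendsto_mse:
  assumes "(C \<longlongrightarrow> C') F" and "(u \<longlongrightarrow> u') F"
  shows "((\<lambda>n. mse s (C n) (u n) k) \<longlongrightarrow> mse s C' u' k) F"
  unfolding mse_def by (intro tendsto_intros assms)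

lemma tendsto_mmse_receiver:
  assumes "valid_system s" and "(C \<longlongrightarrow> C') F"
  shows "((\<lambda>n. mmse_receiver s (C n)) \<longlongrightarrow> mmse_receiver s C') F"
proof -
  have "alpha_q s * (\<Sum>j\<in>UNIV. (cmod (C' $ k $ j))\<^sup>2) + noise_var s \<noteq> 0" for k
    using interference_pos [OF assms(1), of C' k] unfolding signal_plus_interference [symmetric]
    by (simp add: add_nonneg_pos less_imp_neq [symmetric])
  then show ?thesis
    unfolding mmse_receiver_def of_real_eq_0_iff [symmetric, where 'a = complex]
    by (intro tendsto_vec_lambda tendsto_intros assms(2))
qed

text \<open>Here the base point varies and the argument \<open>X\<close> is fixed: surrogates along
  a subsequence converge to the surrogate built at its limit.\<close>

lemma tendsto_rate_minorizer:
  assumes "valid_system s" and "(Xn \<longlongrightarrow> X') F"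
  shows "((\<lambda>n. rate_minorizer s Hb (Xn n) X) \<longlongrightarrow> rate_minorizer s Hb X' X) F"
proof -
  note C = tendsto_matrix_mult_left [OF assms(2), of Hb]
  note u = tendsto_mmse_receiver [OF assms(1) C]
  have "mse s C v k \<noteq> 0" for C :: "complex^'b^'b" and v k
    using mse_pos [OF assms(1), of C v k] by simp
  then show ?thesis
    unfolding rate_minorizer_def Let_def
    by (intro tendsto_intros tendsto_mse C u) auto
qed

text \<open>Affinity is demanded only for weights of sum one, because the term
  \<open>1 - alpha_q u C\<close> of the error has a constant part.\<close>

lemma convex_on_power2_cmod_affine:
  fixes f :: "'z::real_vector \<Rightarrow> complex"
  assumes "\<And>a b u v. u + v = 1 \<Longrightarrow> f (u *\<^sub>R a + v *\<^sub>R b) = of_real u * f a + of_real v * f b"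
  shows "convex_on UNIV (\<lambda>z. (cmod (f z))\<^sup>2)"
proof (rule convex_onI)
  fix t :: real and a b :: 'z
  assume t: "0 < t" "t < 1"
  have "cmod (f ((1 - t) *\<^sub>R a + t *\<^sub>R b)) \<le> (1 - t) * cmod (f a) + t * cmod (f b)"
    using norm_triangle_ineq [of "of_real (1 - t) * f a" "of_real t * f b"] t
    by (simp add: assms norm_mult del: of_real_diff)
  then have "(cmod (f ((1 - t) *\<^sub>R a + t *\<^sub>R b)))\<^sup>2 \<le> ((1 - t) * cmod (f a) + t * cmod (f b))\<^sup>2"
    by (intro power_mono) auto
  also have "\<dots> \<le> (1 - t) * (cmod (f a))\<^sup>2 + t * (cmod (f b))\<^sup>2"
  proof -
    have "(1 - t) * x\<^sup>2 + t * y\<^sup>2 - ((1 - t) * x + t * y)\<^sup>2 = (1 - t) * t * (x - y)\<^sup>2" for x y :: real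
      by (simp add: power2_eq_square algebra_simps)
    then show ?thesis using t by (smt (verit) mult_nonneg_nonneg zero_le_power2)
  qed
  finally show "(cmod (f ((1 - t) *\<^sub>R a + t *\<^sub>R b)))\<^sup>2 \<le> (1 - t) * (cmod (f a))\<^sup>2 + t * (cmod (f b))\<^sup>2" .
qed simp

lemma matrix_mult_affine:
  fixes A :: "complex^'n^'m"
  shows "(A ** (u *\<^sub>R X + v *\<^sub>R Y)) $ i $ j = of_real u * (A ** X) $ i $ j + of_real v * (A ** Y) $ i $ j"
  by (simp add: matrix_matrix_mult_def sum_distrib_left scaleR_conv_of_real [where 'a = complex] algebra_simps flip: sum.distrib)

lemma convex_on_sum_functions:
  assumes "finite I" and "\<And>i. i \<in> I \<Longrightarrow> convex_on UNIV (f i)"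
  shows "convex_on UNIV (\<lambda>x. \<Sum>i\<in>I. f i x)"
  using assms
proof (induction rule: finite_induct)
  case empty
  show ?case by (simp add: convex_on_const)
next
  case (insert i I)
  then show ?case by (simp add: convex_on_add)
qed

lemma convex_on_mse:
  fixes Hb :: "complex^'k^'k"
  assumes "valid_system s"
  shows "convex_on UNIV (\<lambda>X. mse s (Hb ** X) u k)"
proof -
  have ab: "0 < alpha_q s" "0 < beta_q s" "0 < noise_var s"
    using assms alpha_q_pos by (auto simp: valid_system_def)
  have C: "convex_on UNIV (\<lambda>X :: complex^'k^'k. (cmod ((Hb ** X) $ k $ j))\<^sup>2)" for j
    by (rule convex_on_power2_cmod_affine) (simp add: matrix_mult_affine)
  have "convex_on UNIV (\<lambda>X :: complex^'k^'k. (cmod (1 - complex_of_real (alpha_q s) * u $ k * (Hb ** X) $ k $ k))\<^sup>2)"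
  proof (rule convex_on_power2_cmod_affine)
    fix X Y :: "complex^'k^'k" and a b :: real
    assume "a + b = 1"
    then have "complex_of_real a + complex_of_real b = 1"
      by (metis of_real_1 of_real_add)
    then show "1 - complex_of_real (alpha_q s) * u $ k * (Hb ** (a *\<^sub>R X + b *\<^sub>R Y)) $ k $ k
        = of_real a * (1 - complex_of_real (alpha_q s) * u $ k * (Hb ** X) $ k $ k)
          + of_real b * (1 - complex_of_real (alpha_q s) * u $ k * (Hb ** Y) $ k $ k)"
      by (simp add: matrix_mult_affine algebra_simps)
  qed
  then show ?thesis
    unfolding mse_def using ab
    by (intro convex_on_add convex_on_cmul convex_on_sum_functions C mult_nonneg_nonneg) (auto simp: convex_on_const)
qed

text \<open>With receivers and weights frozen, the minorizer is a constant minus a nonnegative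
  combination of convex quadratics.\<close>

lemma concave_on_rate_minorizer:
  fixes Hb :: "complex^'k^'k"
  assumes "valid_system s"
  shows "concave_on UNIV (rate_minorizer s Hb Xn)"
proof -
  let ?u = "mmse_receiver s (Hb ** Xn)"
  have "convex_on UNIV (\<lambda>X. 1 / ln 2 * (\<Sum>k\<in>UNIV. 1 / mse s (Hb ** Xn) ?u k * mse s (Hb ** X) ?u k))"
    using mse_pos [OF assms]
    by (intro convex_on_cmul convex_on_sum_functions convex_on_mse assms) (auto intro: less_imp_le)
  moreover have "rate_minorizer s Hb Xn = (\<lambda>X. 1 / ln 2 * (\<Sum>k\<in>UNIV. ln (1 / mse s (Hb ** Xn) ?u k) + 1) -
      1 / ln 2 * (\<Sum>k\<in>UNIV. 1 / mse s (Hb ** Xn) ?u k * mse s (Hb ** X) ?u k))"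
    by (simp add: fun_eq_iff rate_minorizer_def Let_def sum_subtractf diff_divide_distrib)
  ultimately show ?thesis
    by (auto intro!: concave_on_diff simp: concave_on_const)
qed

section \<open>The lifted problem and its subproblems\<close>

lemma feasible_lifted_program:
  "feasible (lifted_program s Hb \<rho> \<tau>) (X, p, r, t, x, y) \<longleftrightarrow>
     r \<le> \<rho> X \<and> t \<le> bandwidth s * \<tau> x y \<and> x\<^sup>2 \<le> r \<and> P_tot s p \<le> y \<and> tx_power s p \<le> p_max s \<and>
     0 \<le> r \<and> 0 \<le> t \<and> 0 \<le> x \<and> 0 \<le> y \<and> loewner_le (ctranspose X ** Hb ** X) (diag_mat p)"
  by (auto simp: feasible_def lifted_program_def loewner_le_def)

lemma objective_lifted_program:
  "objective (lifted_program s Hb \<rho> \<tau>) (X, p, r, t, x, y) =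
     weight s * (r / R_ref s) + (1 - weight s) * (t / EE_ref s)"
  by (simp add: lifted_program_def)

lemma scaleR_matrix_mult:
  fixes A :: "complex^'n^'m"
  shows "(c *\<^sub>R A) ** B = c *\<^sub>R (A ** B)" and "A ** (c *\<^sub>R B) = c *\<^sub>R (A ** B)"
  by (simp_all add: vec_eq_iff matrix_matrix_mult_def scaleR_sum_right)

lemma ctranspose_add: "ctranspose (A + B) = ctranspose A + ctranspose B"
  by (simp add: vec_eq_iff)

lemma ctranspose_scaleR: "ctranspose (c *\<^sub>R A) = c *\<^sub>R ctranspose A"
  by (simp add: vec_eq_iff)

lemma diag_mat_affine: "diag_mat (u *\<^sub>R p + v *\<^sub>R q) = u *\<^sub>R diag_mat p + v *\<^sub>R diag_mat q"
  by (simp add: vec_eq_iff diag_mat_nth scaleR_conv_of_real [where 'a = complex])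

lemma matrix_add_rdistrib: "(B + C) ** A = B ** A + C ** A" for A :: "complex^'n^'m"
  by (simp add: vec_eq_iff matrix_matrix_mult_def distrib_right sum.distrib)

lemma pos_semidef_scaleR: "0 \<le> c \<Longrightarrow> pos_semidef A \<Longrightarrow> pos_semidef (c *\<^sub>R A)"
  by (simp add: pos_semidef_def hermitian_def ctranspose_scaleR Re_quad_form scaleR_mult_vec)

text \<open>The convexity gap is \<open>u v\<close> times the congruence of \<open>Hb\<close> by
  \<open>X - Y\<close>; the diagonal part is affine and cancels.\<close>

lemma loewner_convex_gram:
  fixes Hb :: "complex^'k^'k"
  assumes "pos_semidef Hb"
  shows "loewner_convex (\<lambda>(X :: complex^'k^'k, p, w :: 'w::real_vector). ctranspose X ** Hb ** X - diag_mat p)"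
proof -
  have "pos_semidef (u *\<^sub>R (ctranspose X ** Hb ** X - diag_mat p) + v *\<^sub>R (ctranspose Y ** Hb ** Y - diag_mat q)
      - (ctranspose (u *\<^sub>R X + v *\<^sub>R Y) ** Hb ** (u *\<^sub>R X + v *\<^sub>R Y) - diag_mat (u *\<^sub>R p + v *\<^sub>R q)))"
    if uv: "0 \<le> u" "0 \<le> v" "u + v = 1" for u v and X Y :: "complex^'k^'k" and p q
  proof -
    have v: "v = 1 - u" using uv by simp
    have "u *\<^sub>R (ctranspose X ** Hb ** X) + v *\<^sub>R (ctranspose Y ** Hb ** Y)
        - ctranspose (u *\<^sub>R X + v *\<^sub>R Y) ** Hb ** (u *\<^sub>R X + v *\<^sub>R Y)
        = (u * v) *\<^sub>R (ctranspose (X - Y) ** Hb ** (X - Y))"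
      unfolding v
      by (simp add: ctranspose_add ctranspose_diff ctranspose_scaleR matrix_add_ldistrib matrix_add_rdistrib
          matrix_diff_ldistrib matrix_diff_rdistrib scaleR_matrix_mult algebra_simps)
    then have "u *\<^sub>R (ctranspose X ** Hb ** X - diag_mat p) + v *\<^sub>R (ctranspose Y ** Hb ** Y - diag_mat q)
        - (ctranspose (u *\<^sub>R X + v *\<^sub>R Y) ** Hb ** (u *\<^sub>R X + v *\<^sub>R Y) - diag_mat (u *\<^sub>R p + v *\<^sub>R q))
        = (u * v) *\<^sub>R (ctranspose (X - Y) ** Hb ** (X - Y))"
      by (simp add: diag_mat_affine algebra_simps)
    moreover have "pos_semidef ((u * v) *\<^sub>R (ctranspose (X - Y) ** Hb ** (X - Y)))"
      using uv by (intro pos_semidef_scaleR pos_semidef_congruence assms) simp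
    ultimately show ?thesis by simp
  qed
  then show ?thesis
    unfolding loewner_convex_def loewner_le_def by (simp add: split_paired_all)
qed

lemma tx_power_affine: "tx_power s (u *\<^sub>R p + v *\<^sub>R q) = u * tx_power s p + v * tx_power s q"
  by (simp add: tx_power_def sum.distrib sum_distrib_left algebra_simps)

lemma P_tot_affine: "u + v = 1 \<Longrightarrow> P_tot s (u *\<^sub>R p + v *\<^sub>R q) = u * P_tot s p + v * P_tot s q"
  by (simp add: P_tot_def tx_power_affine add_divide_distrib algebra_simps flip: distrib_right)

lemma ratio_minorizer_linear:
  "ratio_minorizer xn yn (u * x + v * x') (u * y + v * y') = u * ratio_minorizer xn yn x y + v * ratio_minorizer xn yn x' y'"
  by (simp add: ratio_minorizer_def algebra_simps add_divide_distrib)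

lemma convex_program_lifted_program:
  fixes Hb :: "complex^'k^'k"
  assumes Hb: "pos_semidef Hb" and \<rho>: "concave_on UNIV \<rho>"
    and \<tau>: "\<And>u v x y x' y'. \<tau> (u * x + v * x') (u * y + v * y') = u * \<tau> x y + v * \<tau> x' y'"
  shows "convex_program (lifted_program s Hb \<rho> \<tau>)"
proof -
  \<comment> \<open>All scalar constraints except the rate bound and
    \<open>x\<^sup>2 \<le> r\<close> are affine, as is the objective.\<close>
  have lin: "convex_on UNIV f"
    if "\<And>u v a b. u + v = 1 \<Longrightarrow> f (u *\<^sub>R a + v *\<^sub>R b) = u * f a + v * f b" for f :: "'k point \<Rightarrow> real"
    using that by (simp add: convex_on_def)
  have sq: "(u * x + v * x')\<^sup>2 \<le> u * x\<^sup>2 + v * x'\<^sup>2" if "0 \<le> u" "0 \<le> v" "u + v = 1" for u v x x' :: real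
  proof -
    have "u * x\<^sup>2 + (1 - u) * x'\<^sup>2 - (u * x + (1 - u) * x')\<^sup>2 = u * (1 - u) * (x - x')\<^sup>2"
      by (simp add: power2_eq_square algebra_simps)
    moreover have "v = 1 - u" using that by simp
    ultimately show ?thesis using that by (smt (verit) mult_nonneg_nonneg zero_le_power2)
  qed
  have "convex_on UNIV (\<lambda>(X, p, r, t, x, y). r - \<rho> X)"
    using \<rho> unfolding convex_on_def concave_on_iff by (force simp: algebra_simps)
  moreover have "convex_on UNIV (\<lambda>(X :: complex^'k^'k, p :: real^'k, r :: real, t :: real, x :: real, y :: real). x\<^sup>2 - r)"
    by (auto simp: convex_on_def right_diff_distrib) (smt (verit) sq)
  moreover have "concave_on UNIV (\<lambda>(X :: complex^'k^'k, p :: real^'k, r, t, x :: real, y :: real).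
       weight s * (r / R_ref s) + (1 - weight s) * (t / EE_ref s))"
    unfolding concave_on_def by (rule lin) (auto simp: algebra_simps add_divide_distrib diff_divide_distrib)
  moreover have "convex_on UNIV (\<lambda>(X :: complex^'k^'k, p :: real^'k, r :: real, t, x, y). t - bandwidth s * \<tau> x y)"
    "convex_on UNIV (\<lambda>(X :: complex^'k^'k, p :: real^'k, r :: real, t :: real, x :: real, y). P_tot s p - y)"
    "convex_on UNIV (\<lambda>(X :: complex^'k^'k, p :: real^'k, r :: real, t :: real, x :: real, y :: real). tx_power s p - p_max s)"
    "convex_on UNIV (\<lambda>(X :: complex^'k^'k, p :: real^'k, r :: real, t :: real, x :: real, y :: real). - r)"
    "convex_on UNIV (\<lambda>(X :: complex^'k^'k, p :: real^'k, r :: real, t :: real, x :: real, y :: real). - t)"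
    "convex_on UNIV (\<lambda>(X :: complex^'k^'k, p :: real^'k, r :: real, t :: real, x :: real, y :: real). - x)"
    "convex_on UNIV (\<lambda>(X :: complex^'k^'k, p :: real^'k, r :: real, t :: real, x :: real, y :: real). - y)"
    by (rule lin; auto simp: \<tau> tx_power_affine P_tot_affine algebra_simps simp flip: distrib_right)+
  moreover have "loewner_convex (\<lambda>(X :: complex^'k^'k, p, r :: real, t :: real, x :: real, y :: real).
      ctranspose X ** Hb ** X - diag_mat p)"
    using loewner_convex_gram [OF Hb, where 'w = "real \<times> real \<times> real \<times> real"]
    by (simp add: case_prod_unfold)
  ultimately show ?thesis
    unfolding convex_program_def lifted_program_def by simp
qed

lemma convex_program_subproblem:
  assumes "valid_system s"
  shows "convex_program (subproblem s (gram H) z)"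
  unfolding subproblem_def
  by (cases z) (simp add: convex_program_lifted_program pos_semidef_gram concave_on_rate_minorizer [OF assms]
      ratio_minorizer_linear)

section \<open>Feasibility along the scheme\<close>

lemma ratio_minorizer_touches: "ratio_minorizer xn yn xn yn = xn\<^sup>2 / yn"
  by (cases "yn = 0") (simp_all add: ratio_minorizer_def power2_eq_square field_simps)

text \<open>For \<open>yn > 0\<close> the minorizer is the tangent plane of the convex function
  \<open>x\<^sup>2 / y\<close> at \<open>(xn, yn)\<close>; the gap is a square divided by
  \<open>y\<close>.\<close>

lemma ratio_minorizer_le:
  assumes "0 < y" shows "ratio_minorizer xn yn x y \<le> x\<^sup>2 / y"
proof -
  define a where "a = xn / yn"
  have "x\<^sup>2 / y - (2 * a * x - a\<^sup>2 * y) = (x - a * y)\<^sup>2 / y"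
    using assms by (simp add: field_simps power2_eq_square)
  also have "0 \<le> \<dots>" using assms by simp
  finally show ?thesis by (simp add: ratio_minorizer_def a_def)
qed

lemma P_tot_ge_static:
  assumes "valid_system s" and "\<And>k. 0 \<le> p $ k"
  shows "p_static s \<le> P_tot s p"
  using assms alpha_q_pos [OF assms(1)]
  by (simp add: P_tot_def tx_power_def valid_system_def sum_nonneg)

lemma p_static_pos: "valid_system s \<Longrightarrow> 0 < p_static s"
  by (simp add: valid_system_def)

lemma feasible_problem_L:
  "feasible (problem_L s Hb) (X, p, r, t, x, y) \<longleftrightarrow>
     r \<le> rate s (Hb ** X) \<and> t \<le> bandwidth s * (x\<^sup>2 / y) \<and> x\<^sup>2 \<le> r \<and> P_tot s p \<le> y \<and> tx_power s p \<le> p_max s \<and>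
     0 \<le> r \<and> 0 \<le> t \<and> 0 \<le> x \<and> 0 \<le> y \<and> loewner_le (ctranspose X ** Hb ** X) (diag_mat p)"
  unfolding problem_L_def feasible_lifted_program ..

lemma feasible_subproblem:
  "feasible (subproblem s Hb (Xn, pn, rn, tn, xn, yn)) (X, p, r, t, x, y) \<longleftrightarrow>
     r \<le> rate_minorizer s Hb Xn X \<and> t \<le> bandwidth s * ratio_minorizer xn yn x y \<and> x\<^sup>2 \<le> r \<and> P_tot s p \<le> y \<and>
     tx_power s p \<le> p_max s \<and> 0 \<le> r \<and> 0 \<le> t \<and> 0 \<le> x \<and> 0 \<le> y \<and>
     loewner_le (ctranspose X ** Hb ** X) (diag_mat p)"
  by (simp add: subproblem_def feasible_lifted_program)

lemma feasible_problem_L_imp_subproblem: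
  assumes "valid_system s" and "feasible (problem_L s Hb) z"
  shows "feasible (subproblem s Hb z) z"
  using assms
  by (cases z) (simp add: feasible_problem_L feasible_subproblem rate_minorizer_touches ratio_minorizer_touches)

text \<open>The Loewner constraint forces nonnegative powers, so the static power bounds
  \<open>y\<close> away from zero, also in the limit.\<close>

lemma feasible_power:
  assumes "valid_system s" and "loewner_le (ctranspose X ** gram H ** X) (diag_mat p)" and "P_tot s p \<le> y"
  shows "p_static s \<le> y" and "0 < y"
  using P_tot_ge_static [OF assms(1) loewner_le_gram_nonneg [OF assms(2)]] p_static_pos [OF assms(1)] assms(3)
  by linarith+

lemma feasible_subproblem_imp_problem_L:
  assumes "valid_system s" and "feasible (subproblem s (gram H) z) w"
  shows "feasible (problem_L s (gram H)) w"
proof -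
  obtain Xn pn rn tn xn yn where z: "z = (Xn, pn, rn, tn, xn, yn)" by (cases z)
  obtain X p r t x y where w: "w = (X, p, r, t, x, y)" by (cases w)
  note f = assms(2) [unfolded z w feasible_subproblem]
  have "0 < y" using f by (blast intro: feasible_power(2) [OF assms(1)])
  then have "bandwidth s * ratio_minorizer xn yn x y \<le> bandwidth s * (x\<^sup>2 / y)"
    using assms(1) by (intro mult_left_mono ratio_minorizer_le) (auto simp: valid_system_def)
  then show ?thesis
    using f rate_minorizer_le [OF assms(1), of "gram H" Xn X] unfolding w feasible_problem_L by linarith
qed

lemma sca_init_feasible:
  assumes "valid_system s" and "sca_init s (gram H) z"
  shows "feasible (problem_L s (gram H)) z"
proof -
  obtain X p r t x y where z: "z = (X, p, r, t, x, y)" by (cases z)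
  note i = assms(2) [unfolded z sca_init_def prod.case]
  have "0 < y" using i by (intro feasible_power(2) [OF assms(1), of X H p]) auto
  moreover have "0 \<le> r" using i rate_nonneg [OF assms(1)] by simp
  ultimately show ?thesis
    using i assms(1) by (simp add: z feasible_problem_L valid_system_def)
qed

lemma sca_sequence_feasible:
  assumes "valid_system s" and "sca_sequence s (gram H) z"
  shows "feasible (problem_L s (gram H)) (z n)"
proof (cases n)
  case 0
  then show ?thesis using assms(2) sca_init_feasible [OF assms(1), of H "z 0"] by (simp add: sca_sequence_def)
next
  case (Suc m)
  then have "feasible (subproblem s (gram H) (z m)) (z n)"
    using assms(2) by (auto simp: sca_sequence_def maximizer_def is_arg_max_def)
  then show ?thesis by (rule feasible_subproblem_imp_problem_L [OF assms(1)])
qed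

text \<open>Only \<open>r\<close> and \<open>t\<close> enter the objective of (L); evaluated at the
  rate and the energy efficiency, the same function is the objective of (T).\<close>

definition lifted_value :: "system \<Rightarrow> real \<Rightarrow> real \<Rightarrow> real" where
  "lifted_value s r t = weight s * (r / R_ref s) + (1 - weight s) * (t / EE_ref s)"

lemma objective_subproblem: "objective (subproblem s Hb z) = objective (problem_L s Hb)"
  by (cases z) (simp add: subproblem_def problem_L_def lifted_program_def)

lemma objective_problem_L: "objective (problem_L s Hb) (X, p, r, t, x, y) = lifted_value s r t"
  by (simp add: problem_L_def objective_lifted_program lifted_value_def)

lemma lifted_value_mono:
  assumes "valid_system s" "r \<le> r'" "t \<le> t'"
  shows "lifted_value s r t \<le> lifted_value s r' t'"
  using assms unfolding lifted_value_def valid_system_def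
  by (intro add_mono mult_left_mono divide_right_mono) auto

lemma sca_maximal:
  assumes "sca_sequence s Hb z" and "feasible (subproblem s Hb (z n)) w"
  shows "objective (problem_L s Hb) w \<le> objective (problem_L s Hb) (z (Suc n))"
  using assms unfolding sca_sequence_def maximizer_def is_arg_max_def objective_subproblem
  by (meson not_le_imp_less)

text \<open>The current iterate competes in its own subproblem, and all subproblems share the
  objective of (L).\<close>

lemma sca_incseq:
  assumes "valid_system s" and "sca_sequence s (gram H) z"
  shows "incseq (\<lambda>n. objective (problem_L s (gram H)) (z n))"
  by (intro incseq_SucI sca_maximal [OF assms(2)] feasible_problem_L_imp_subproblem
      sca_sequence_feasible assms)

text \<open>Besides bounding the objective from above, this shows that a small \<open>r\<close>
  forces a small objective.\<close>

lemma feasible_problem_L_le: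
  fixes H :: "complex^'n^'k"
  assumes s: "valid_system s" and f: "feasible (problem_L s (gram H)) (X, p, r, t, x, y)"
  shows "t \<le> bandwidth s * (r / p_static s)"
proof -
  note f' = f [unfolded feasible_problem_L]
  have y: "p_static s \<le> y" using f' feasible_power(1) [OF s] by blast
  have "x\<^sup>2 / y \<le> r / p_static s"
    using f' p_static_pos [OF s] y by (intro frac_le) auto
  then have "bandwidth s * (x\<^sup>2 / y) \<le> bandwidth s * (r / p_static s)"
    using s by (intro mult_left_mono) (auto simp: valid_system_def)
  then show ?thesis using f' by linarith
qed

lemma sca_convergent:
  fixes H :: "complex^'n^'k" and z :: "nat \<Rightarrow> 'k point"
  assumes s: "valid_system s" and z: "sca_sequence s (gram H) z"
  shows "convergent (\<lambda>n. objective (problem_L s (gram H)) (z n))"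
proof -
  define M where "M = CARD('k) * log 2 (1 + alpha_q s / beta_q s)"
  have "objective (problem_L s (gram H)) (z n) \<le> lifted_value s M (bandwidth s * (M / p_static s))" for n
  proof -
    obtain X p r t x y where zn: "z n = (X, p, r, t, x, y)" by (cases "z n")
    have f: "feasible (problem_L s (gram H)) (X, p, r, t, x, y)"
      using sca_sequence_feasible [OF assms, of n] zn by simp
    have "r \<le> M"
      using f rate_le [OF s, of "gram H ** X"] by (simp add: feasible_problem_L M_def)
    then have "bandwidth s * (r / p_static s) \<le> bandwidth s * (M / p_static s)"
      using s by (intro mult_left_mono divide_right_mono) (auto simp: valid_system_def)
    then show ?thesis
      unfolding zn objective_problem_L using \<open>r \<le> M\<close> feasible_problem_L_le [OF s f]
      by (intro lifted_value_mono s) auto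
  qed
  then show ?thesis
    using sca_incseq [OF assms] incseq_convergent convergent_def by metis
qed

section \<open>Limit points\<close>

text \<open>The constraint \<open>0 \<le> t\<close> makes the ratio minorizer nonnegative, which for
  \<open>xn > 0\<close> forces \<open>x > 0\<close>. Slack in \<open>x\<^sup>2 \<le> r\<close> could
  be traded for a larger \<open>t\<close>, because the minorizer increases strictly in
  \<open>x\<close>.\<close>

lemma sca_step:
  fixes H :: "complex^'n^'k"
  assumes s: "valid_system s" and z: "sca_sequence s (gram H) z"
    and zn: "z n = (Xn, pn, rn, tn, xn, yn)" and zS: "z (Suc n) = (X, p, r, t, x, y)" and "0 < xn"
  shows "0 < x" and "x\<^sup>2 = r"
proof -
  have f: "feasible (subproblem s (gram H) (Xn, pn, rn, tn, xn, yn)) (X, p, r, t, x, y)"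
    using z zn zS unfolding sca_sequence_def maximizer_def is_arg_max_def by metis
  note f' = f [unfolded feasible_subproblem]
  have B: "0 < bandwidth s" using s by (simp add: valid_system_def)
  have "0 < y" using f' by (blast intro: feasible_power(2) [OF s])
  have fn: "feasible (problem_L s (gram H)) (Xn, pn, rn, tn, xn, yn)"
    using sca_sequence_feasible [OF s z, of n] zn by simp
  have "0 < yn"
    using fn [unfolded feasible_problem_L] by (blast intro: feasible_power(2) [OF s])
  have "0 \<le> bandwidth s * ratio_minorizer xn yn x y" using f' by linarith
  then have "0 \<le> ratio_minorizer xn yn x y" using B by (simp add: zero_le_mult_iff)
  moreover have "0 < (xn / yn)\<^sup>2 * y" using \<open>0 < y\<close> \<open>0 < yn\<close> \<open>0 < xn\<close> by simp
  ultimately have "0 < 2 * xn / yn * x" unfolding ratio_minorizer_def by linarith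
  then show "0 < x" using \<open>0 < yn\<close> \<open>0 < xn\<close> by (simp add: zero_less_mult_iff zero_less_divide_iff)
  show "x\<^sup>2 = r"
  proof (rule ccontr)
    assume "x\<^sup>2 \<noteq> r"
    then have "x\<^sup>2 < r" using f' by simp
    then have "x < sqrt r" by (rule real_less_rsqrt)
    define d where "d = bandwidth s * (2 * xn / yn * (sqrt r - x))"
    have "0 < d" using B \<open>0 < yn\<close> \<open>0 < xn\<close> \<open>x < sqrt r\<close> by (simp add: d_def)
    have "bandwidth s * ratio_minorizer xn yn (sqrt r) y = bandwidth s * ratio_minorizer xn yn x y + d"
      by (simp add: ratio_minorizer_def d_def algebra_simps diff_divide_distrib)
    then have "feasible (subproblem s (gram H) (z n)) (X, p, r, t + d, sqrt r, y)"
      unfolding zn feasible_subproblem using f' \<open>0 < d\<close> by simp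
    from sca_maximal [OF z this] have "lifted_value s r (t + d) \<le> lifted_value s r t"
      by (simp add: zS objective_problem_L)
    moreover have "0 < (1 - weight s) * (d / EE_ref s)"
      using s \<open>0 < d\<close> by (simp add: valid_system_def)
    ultimately show False by (simp add: lifted_value_def add_divide_distrib algebra_simps)
  qed
qed

lemma lifted_value_homogeneous: "lifted_value s r (b * (r / q)) = r * lifted_value s 1 (b / q)"
  by (simp add: lifted_value_def algebra_simps)

lemma lifted_value_pos:
  assumes "valid_system s" "0 < r" "0 \<le> t" shows "0 < lifted_value s r t"
  using assms unfolding lifted_value_def valid_system_def by (intro add_pos_nonneg) auto

lemma x_part_simp [simp]: "x_part (X, p, r, t, x, y) = x"
  by (simp add: x_part_def)

text \<open>The objective is at most \<open>c r\<close> and, being nondecreasing, at least its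
  positive value at \<open>n0\<close>. The inequality \<open>n0 < n\<close> is strict because
  \<open>x\<^sup>2 = r\<close> is obtained from the maximality of a successor.\<close>

lemma sca_eventually_active:
  fixes H :: "complex^'n^'k"
  assumes s: "valid_system s" and z: "sca_sequence s (gram H) z" and "0 < x_part (z n0)"
  obtains \<delta> where "0 < \<delta>"
    and "\<And>n X p r t x y. n0 < n \<Longrightarrow> z n = (X, p, r, t, x, y) \<Longrightarrow> x\<^sup>2 = r \<and> \<delta> \<le> r"
proof -
  let ?f = "\<lambda>n. objective (problem_L s (gram H)) (z n)"
  have pos: "0 < x_part (z n)" if "n0 \<le> n" for n
    using that
  proof (induction n rule: dec_induct)
    case (step n)
    obtain X p r t x y where "z n = (X, p, r, t, x, y)" by (cases "z n")
    moreover obtain X' p' r' t' x' y' where "z (Suc n) = (X', p', r', t', x', y')" by (cases "z (Suc n)")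
    ultimately show ?case using sca_step(1) [OF s z] step.IH by fastforce
  qed (rule assms(3))
  define c where "c = lifted_value s 1 (bandwidth s / p_static s)"
  have "0 < c"
    using s unfolding c_def by (intro lifted_value_pos) (auto simp: valid_system_def)
  have "0 < ?f n0"
  proof -
    obtain X p r t x y where z0: "z n0 = (X, p, r, t, x, y)" by (cases "z n0")
    have "feasible (problem_L s (gram H)) (X, p, r, t, x, y)"
      using sca_sequence_feasible [OF s z, of n0] z0 by simp
    then have "x\<^sup>2 \<le> r" "0 \<le> t" by (simp_all add: feasible_problem_L)
    moreover have "0 < x\<^sup>2" using assms(3) z0 by simp
    ultimately show ?thesis unfolding z0 objective_problem_L by (intro lifted_value_pos s) linarith+
  qed
  show thesis
  proof
    show "0 < ?f n0 / c" using \<open>0 < ?f n0\<close> \<open>0 < c\<close> by simp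
    fix n X p r t x y
    assume n: "n0 < n" and zn: "z n = (X, p, r, t, x, y)"
    obtain m where m: "n = Suc m" "n0 \<le> m" using n by (cases n) auto
    obtain X' p' r' t' x' y' where zm: "z m = (X', p', r', t', x', y')" by (cases "z m")
    have "x\<^sup>2 = r"
      using sca_step(2) [OF s z zm] zn m pos [OF m(2)] zm by simp
    moreover have "?f n0 \<le> ?f n"
      using sca_incseq [OF s z] n by (simp add: incseq_def)
    moreover have "?f n \<le> r * c"
    proof -
      have f: "feasible (problem_L s (gram H)) (X, p, r, t, x, y)"
        using sca_sequence_feasible [OF s z, of n] zn by simp
      have "lifted_value s r t \<le> lifted_value s r (bandwidth s * (r / p_static s))"
        by (intro lifted_value_mono s feasible_problem_L_le [OF s f]) simp
      then show ?thesis unfolding zn objective_problem_L c_def lifted_value_homogeneous .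
    qed
    ultimately show "x\<^sup>2 = r \<and> ?f n0 / c \<le> r"
      using \<open>0 < c\<close> by (auto simp: pos_divide_le_eq intro: order_trans)
  qed
qed

locale sca_limit =
  fixes s :: system and H :: "complex^'n^'k" and z :: "nat \<Rightarrow> 'k point"
    and \<kappa> :: "nat \<Rightarrow> nat" and X p r t x y
  assumes s: "valid_system s" and z: "sca_sequence s (gram H) z"
    and \<kappa>: "strict_mono \<kappa>" and lim: "(z \<circ> \<kappa>) \<longlonglongrightarrow> (X, p, r, t, x, y)"
    and active: "\<exists>n. 0 < x_part (z n)"
begin

definition "Xs n = fst (z (\<kappa> n))"
definition "ps n = fst (snd (z (\<kappa> n)))"
definition "rs n = fst (snd (snd (z (\<kappa> n))))"
definition "ts n = fst (snd (snd (snd (z (\<kappa> n)))))"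
definition "xs n = fst (snd (snd (snd (snd (z (\<kappa> n))))))"
definition "ys n = snd (snd (snd (snd (snd (z (\<kappa> n))))))"

lemma iterate: "z (\<kappa> n) = (Xs n, ps n, rs n, ts n, xs n, ys n)"
  by (simp add: Xs_def ps_def rs_def ts_def xs_def ys_def)

lemma lims: "Xs \<longlonglongrightarrow> X" "ps \<longlonglongrightarrow> p" "rs \<longlonglongrightarrow> r" "ts \<longlonglongrightarrow> t" "xs \<longlonglongrightarrow> x" "ys \<longlonglongrightarrow> y"
proof -
  have l: "(\<lambda>n. z (\<kappa> n)) \<longlonglongrightarrow> (X, p, r, t, x, y)" using lim by (simp add: o_def)
  note l1 = tendsto_snd [OF l] 
  note l2 = tendsto_snd [OF l1]
  note l3 = tendsto_snd [OF l2]
  note l4 = tendsto_snd [OF l3]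
  show "Xs \<longlonglongrightarrow> X" "ps \<longlonglongrightarrow> p" "rs \<longlonglongrightarrow> r" "ts \<longlonglongrightarrow> t" "xs \<longlonglongrightarrow> x" "ys \<longlonglongrightarrow> y"
    using tendsto_fst [OF l] tendsto_fst [OF l1] tendsto_fst [OF l2] tendsto_fst [OF l3] tendsto_fst [OF l4] tendsto_snd [OF l4]
    unfolding Xs_def ps_def rs_def ts_def xs_def ys_def by simp_all
qed

lemma iterate_feasible:
  "rs n \<le> rate s (gram H ** Xs n)" "ts n \<le> bandwidth s * ((xs n)\<^sup>2 / ys n)" "P_tot s (ps n) \<le> ys n"
  "tx_power s (ps n) \<le> p_max s" "0 \<le> ts n" "0 \<le> xs n" "p_static s \<le> ys n"
  "loewner_le (ctranspose (Xs n) ** gram H ** Xs n) (diag_mat (ps n))"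
proof -
  have "feasible (problem_L s (gram H)) (Xs n, ps n, rs n, ts n, xs n, ys n)"
    using sca_sequence_feasible [OF s z, of "\<kappa> n"] by (simp add: iterate)
  then show "rs n \<le> rate s (gram H ** Xs n)" "ts n \<le> bandwidth s * ((xs n)\<^sup>2 / ys n)" "P_tot s (ps n) \<le> ys n"
    "tx_power s (ps n) \<le> p_max s" "0 \<le> ts n" "0 \<le> xs n"
    "loewner_le (ctranspose (Xs n) ** gram H ** Xs n) (diag_mat (ps n))" "p_static s \<le> ys n"
    unfolding feasible_problem_L by (auto intro: feasible_power(1) [OF s])
qed

lemma limit_loewner: "loewner_le (ctranspose X ** gram H ** X) (diag_mat p)"
  unfolding loewner_le_gram_iff
proof
  fix v :: "complex^'k"
  have "(\<lambda>n. (norm (ctranspose H *v (Xs n *v v)))\<^sup>2) \<longlonglongrightarrow> (norm (ctranspose H *v (X *v v)))\<^sup>2"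
    unfolding matrix_vector_mult_def [of "Xs _"] matrix_vector_mult_def [of X]
    by (intro tendsto_intros bounded_linear.tendsto [OF matrix_vector_mul_bounded_linear] tendsto_vec_lambda lims)
  moreover have "(\<lambda>n. \<Sum>j\<in>UNIV. ps n $ j * (cmod (v $ j))\<^sup>2) \<longlonglongrightarrow> (\<Sum>j\<in>UNIV. p $ j * (cmod (v $ j))\<^sup>2)"
    by (intro tendsto_intros lims)
  moreover have "(norm (ctranspose H *v (Xs n *v v)))\<^sup>2 \<le> (\<Sum>j\<in>UNIV. ps n $ j * (cmod (v $ j))\<^sup>2)" for n
    using iterate_feasible(8) [of n] unfolding loewner_le_gram_iff matrix_vector_mul_assoc by blast
  ultimately show "(norm ((ctranspose H ** X) *v v))\<^sup>2 \<le> (\<Sum>j\<in>UNIV. p $ j * (cmod (v $ j))\<^sup>2)"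
    unfolding matrix_vector_mul_assoc by (blast intro: LIMSEQ_le)
qed

lemma limit_power: "p_static s \<le> y" "0 < y" "P_tot s p \<le> y" "tx_power s p \<le> p_max s"
proof -
  show "p_static s \<le> y"
    by (rule LIMSEQ_le_const [OF lims(6)]) (use iterate_feasible in blast)
  then show "0 < y" using p_static_pos [OF s] by linarith
  have tx: "(\<lambda>n. tx_power s (ps n)) \<longlonglongrightarrow> tx_power s p"
    unfolding tx_power_def by (intro tendsto_intros lims)
  then show "tx_power s p \<le> p_max s"
    by (rule LIMSEQ_le_const2) (use iterate_feasible in blast)
  have "pa_eff s \<noteq> 0" using s by (simp add: valid_system_def)
  then have "(\<lambda>n. P_tot s (ps n)) \<longlonglongrightarrow> P_tot s p"
    unfolding P_tot_def by (intro tendsto_intros tx)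
  then show "P_tot s p \<le> y"
    by (rule LIMSEQ_le [OF _ lims(6)]) (use iterate_feasible in blast)
qed

lemma limit_le: "r \<le> rate s (gram H ** X)" "t \<le> bandwidth s * (x\<^sup>2 / y)"
proof -
  show "r \<le> rate s (gram H ** X)"
    by (rule LIMSEQ_le [OF lims(3) tendsto_rate [OF s tendsto_matrix_mult_left [OF lims(1)]]])
       (use iterate_feasible in blast)
  have "(\<lambda>n. bandwidth s * ((xs n)\<^sup>2 / ys n)) \<longlonglongrightarrow> bandwidth s * (x\<^sup>2 / y)"
    using limit_power(2) by (intro tendsto_intros lims) simp
  then show "t \<le> bandwidth s * (x\<^sup>2 / y)"
    by (rule LIMSEQ_le [OF lims(4)]) (use iterate_feasible in blast)
qed

lemma limit_pos: "0 < r" "x\<^sup>2 = r" "0 < x"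
proof -
  obtain n0 where "0 < x_part (z n0)" using active by blast
  then obtain \<delta> where \<delta>: "0 < \<delta>"
    "\<And>n X p r t x y. n0 < n \<Longrightarrow> z n = (X, p, r, t, x, y) \<Longrightarrow> x\<^sup>2 = r \<and> \<delta> \<le> r"
    using sca_eventually_active [OF s z] by metis
  \<comment> \<open>\<open>\<kappa> n\<close> is at least \<open>n\<close>, hence beyond
    \<open>n0\<close>.\<close>
  have ev: "(xs n)\<^sup>2 = rs n" "\<delta> \<le> rs n" if "Suc n0 \<le> n" for n
    using \<delta>(2) [OF _ iterate, of n] seq_suble [OF \<kappa>, of n] that by auto
  have "\<delta> \<le> r"
    by (rule LIMSEQ_le_const [OF lims(3)]) (use ev in blast)
  then show "0 < r" using \<delta>(1) by linarith
  have "(\<lambda>n. (xs n)\<^sup>2) \<longlonglongrightarrow> x\<^sup>2" by (intro tendsto_intros lims)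
  moreover have "(\<lambda>n. (xs n)\<^sup>2) \<longlonglongrightarrow> r"
    using lims(3) by (rule Lim_transform_eventually)
      (use ev(1) in \<open>auto simp: eventually_sequentially intro!: exI [of _ "Suc n0"]\<close>)
  ultimately show "x\<^sup>2 = r" by (rule LIMSEQ_unique)
  moreover have "0 \<le> x"
    by (rule LIMSEQ_le_const [OF lims(5)]) (use iterate_feasible in blast)
  ultimately show "0 < x" using \<open>0 < r\<close> by (cases "x = 0") auto
qed

text \<open>A monotone sequence is bounded by the limit of any of its subsequences, so this holds
  off the subsequence as well.\<close>

lemma iterate_value_le: "objective (problem_L s (gram H)) (z n) \<le> lifted_value s r t"
proof -
  let ?f = "\<lambda>n. objective (problem_L s (gram H)) (z n)"
  have "R_ref s \<noteq> 0" "EE_ref s \<noteq> 0" using s by (auto simp: valid_system_def)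
  then have "(\<lambda>n. lifted_value s (rs n) (ts n)) \<longlonglongrightarrow> lifted_value s r t"
    unfolding lifted_value_def by (intro tendsto_intros lims)
  then have "(\<lambda>n. ?f (\<kappa> n)) \<longlonglongrightarrow> lifted_value s r t"
    by (simp add: iterate objective_problem_L)
  moreover have "incseq (\<lambda>n. ?f (\<kappa> n))"
    using sca_incseq [OF s z] strict_mono_mono [OF \<kappa>] by (auto simp: mono_def)
  ultimately have "?f (\<kappa> n) \<le> lifted_value s r t" by (rule incseq_le [rotated])
  moreover have "?f n \<le> ?f (\<kappa> n)"
    using sca_incseq [OF s z] seq_suble [OF \<kappa>, of n] by (simp add: incseq_def)
  ultimately show ?thesis by linarith
qed

text \<open>
  With strict inequalities the comparison point is feasible for the subproblems along the
  subsequence, so maximality passes to the limit.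
\<close>

lemma limit_maximal:
  assumes le: "loewner_le (ctranspose X' ** gram H ** X') (diag_mat p')" and tx: "tx_power s p' \<le> p_max s"
    and q: "0 < rate_minorizer s (gram H) X X'"
    and \<psi>: "0 < ratio_minorizer x y (sqrt (rate_minorizer s (gram H) X X')) (P_tot s p')"
  shows "lifted_value s (rate_minorizer s (gram H) X X')
      (bandwidth s * ratio_minorizer x y (sqrt (rate_minorizer s (gram H) X X')) (P_tot s p'))
    \<le> lifted_value s r t"
proof -
  define q where "q n = rate_minorizer s (gram H) (Xs n) X'" for n
  define \<psi> where "\<psi> n = ratio_minorizer (xs n) (ys n) (sqrt (q n)) (P_tot s p')" for n
  let ?q = "rate_minorizer s (gram H) X X'"
  let ?\<psi> = "ratio_minorizer x y (sqrt ?q) (P_tot s p')"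
  have lq: "q \<longlonglongrightarrow> ?q"
    unfolding q_def by (rule tendsto_rate_minorizer [OF s lims(1)])
  have l\<psi>: "\<psi> \<longlonglongrightarrow> ?\<psi>"
    unfolding \<psi>_def ratio_minorizer_def using limit_power(2) by (intro tendsto_intros lims lq) auto
  have P: "0 < P_tot s p'" using feasible_power(2) [OF s le order_refl] .
  have "R_ref s \<noteq> 0" "EE_ref s \<noteq> 0" using s by (auto simp: valid_system_def)
  then have lv: "(\<lambda>n. lifted_value s (q n) (bandwidth s * \<psi> n)) \<longlonglongrightarrow> lifted_value s ?q (bandwidth s * ?\<psi>)"
    unfolding lifted_value_def by (intro tendsto_intros lq l\<psi>)
  have "\<forall>\<^sub>F n in sequentially. 0 < q n \<and> 0 < \<psi> n"
    using order_tendstoD(1) [OF lq assms(3)] order_tendstoD(1) [OF l\<psi> assms(4)] by eventually_elim simp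
  then have "\<forall>\<^sub>F n in sequentially. lifted_value s (q n) (bandwidth s * \<psi> n) \<le> lifted_value s r t"
  proof eventually_elim
    case (elim n)
    have "feasible (subproblem s (gram H) (z (\<kappa> n))) (X', p', q n, bandwidth s * \<psi> n, sqrt (q n), P_tot s p')"
      unfolding iterate feasible_subproblem using elim le tx P s
      by (auto simp: q_def \<psi>_def valid_system_def)
    \<comment> \<open>The maximizer is the iterate after \<open>\<kappa> n\<close>, which may lie
      off the subsequence; only its value matters.\<close>
    from sca_maximal [OF z this] iterate_value_le [of "Suc (\<kappa> n)"] show ?case
      by (simp add: objective_problem_L)
  qed
  then show ?thesis by (intro tendsto_upperbound [OF lv]) auto
qed

text \<open>The limit itself, with \<open>r\<close> raised to the rate and \<open>y\<close> lowered
  to \<open>P_tot s p\<close>, competes in the surrogate built there. It cannot win, so all gaps,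
  which are nonnegative and enter with positive weights, vanish.\<close>

lemma limit_tight: "r = rate s (gram H ** X)" "x = sqrt r" "y = P_tot s p" "t = bandwidth s * (r / y)"
proof -
  have B: "0 < bandwidth s" using s by (simp add: valid_system_def)
  define R where "R = rate s (gram H ** X)"
  define \<psi> where "\<psi> = ratio_minorizer x y (sqrt R) (P_tot s p)"
  have "r \<le> R" using limit_le(1) by (simp add: R_def)
  show "x = sqrt r" using limit_pos by (metis less_imp_le real_sqrt_unique)
  then have "x \<le> sqrt R" using \<open>r \<le> R\<close> by simp
  \<comment> \<open>The two terms are the gains from raising \<open>x\<close> and from lowering
    \<open>y\<close>.\<close>
  have diff: "\<psi> - x\<^sup>2 / y = 2 * x / y * (sqrt R - x) + (x / y)\<^sup>2 * (y - P_tot s p)"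
    unfolding \<psi>_def ratio_minorizer_touches [symmetric] by (simp add: ratio_minorizer_def algebra_simps diff_divide_distrib)
  have nn: "0 \<le> 2 * x / y * (sqrt R - x)" "0 \<le> (x / y)\<^sup>2 * (y - P_tot s p)"
    using limit_pos limit_power \<open>x \<le> sqrt R\<close> by simp_all
  have "0 < x\<^sup>2 / y" using limit_pos limit_power by simp
  have "x\<^sup>2 / y \<le> \<psi>" using diff nn by linarith
  have m: "rate_minorizer s (gram H) X X = R" unfolding R_def by (rule rate_minorizer_touches [OF s])
  have "lifted_value s R (bandwidth s * \<psi>) \<le> lifted_value s r t"
    using limit_maximal [OF limit_loewner limit_power(4)] limit_pos \<open>r \<le> R\<close> diff nn \<open>0 < x\<^sup>2 / y\<close>
    by (simp add: m flip: \<psi>_def)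
  moreover have t: "t \<le> bandwidth s * (x\<^sup>2 / y)" "bandwidth s * (x\<^sup>2 / y) \<le> bandwidth s * \<psi>"
    using limit_le(2) B mult_left_mono [OF \<open>x\<^sup>2 / y \<le> \<psi>\<close>, of "bandwidth s"] by linarith+
  moreover have "0 \<le> weight s * ((R - r) / R_ref s)" "0 \<le> (1 - weight s) * ((bandwidth s * \<psi> - t) / EE_ref s)"
    using s \<open>r \<le> R\<close> t by (auto simp: valid_system_def)
  moreover have "lifted_value s R (bandwidth s * \<psi>) - lifted_value s r t =
      weight s * ((R - r) / R_ref s) + (1 - weight s) * ((bandwidth s * \<psi> - t) / EE_ref s)"
    by (simp add: lifted_value_def diff_divide_distrib algebra_simps)
  ultimately have "weight s * ((R - r) / R_ref s) = 0" "(1 - weight s) * ((bandwidth s * \<psi> - t) / EE_ref s) = 0"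
    by linarith+
  then have "R = r" "bandwidth s * \<psi> = t"
    using s by (auto simp: valid_system_def)
  then show "r = rate s (gram H ** X)" by (simp add: R_def)
  have "bandwidth s * \<psi> = bandwidth s * (x\<^sup>2 / y)" using \<open>bandwidth s * \<psi> = t\<close> t by linarith
  then have "\<psi> = x\<^sup>2 / y" using B by (metis less_irrefl mult_left_cancel)
  then have "(x / y)\<^sup>2 * (y - P_tot s p) = 0" using diff nn by linarith
  then show "y = P_tot s p" using limit_pos limit_power by simp
  show "t = bandwidth s * (r / y)"
    using \<open>\<psi> = x\<^sup>2 / y\<close> \<open>bandwidth s * \<psi> = t\<close> limit_pos(2) by simp
qed

end

section \<open>First-order conditions\<close>

lemma objective_T_lift:
  "objective_T s H (Y, p) = lifted_value s (rate s (gram H ** lift_T H Y p))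
     (bandwidth s * (rate s (gram H ** lift_T H Y p) / P_tot s p))"
  by (simp add: objective_T_def Let_def mult_precoder_T lifted_value_def)

section \<open>Differentiability of the objective of (T) and of the surrogate\<close>

lemma differentiable_ln:
  fixes f :: "'a::real_normed_vector \<Rightarrow> real"
  assumes "f differentiable (at x within S)" and "0 < f x"
  shows "(\<lambda>x. ln (f x)) differentiable (at x within S)"
proof -
  have "ln differentiable (at (f x))"
    using DERIV_ln [OF assms(2)] real_differentiable_def by blast
  then show ?thesis using assms(1) by (rule differentiable_compose)
qed

lemma differentiable_sqrt:
  fixes f :: "'a::real_normed_vector \<Rightarrow> real"
  assumes "f differentiable (at x within S)" and "0 < f x"
  shows "(\<lambda>x. sqrt (f x)) differentiable (at x within S)"
proof -
  have "sqrt differentiable (at (f x))"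
    using DERIV_real_sqrt [OF assms(2)] real_differentiable_def by blast
  then show ?thesis using assms(1) by (rule differentiable_compose)
qed

lemma differentiable_power2_cmod:
  fixes f :: "'a::real_normed_vector \<Rightarrow> complex"
  assumes "f differentiable (at x within S)"
  shows "(\<lambda>x. (cmod (f x))\<^sup>2) differentiable (at x within S)"
  using differentiable_sqnorm_at assms by (rule differentiable_compose)

lemma differentiable_of_real:
  fixes f :: "'a::real_normed_vector \<Rightarrow> real"
  assumes "f differentiable F"
  shows "(\<lambda>x. complex_of_real (f x)) differentiable F"
  using assms bounded_linear.has_derivative [OF bounded_linear_of_real] unfolding differentiable_def by blast

text \<open>
  For \<open>p \<ge> 0\<close> the squared moduli of the entries of \<open>A ** diag_mat (sqrt_vec p)\<close> are linear in
  \<open>p\<close>, so the objective of (T) is differentiable up to the boundary although \<open>sqrt_vec\<close> is not.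
\<close>

lemma objective_T_differentiable:
  fixes H :: "complex^'n^'k"
  assumes s: "valid_system s" and pd: "pos_def (gram H)" and p: "\<And>k. 0 \<le> p $ k"
  shows "objective_T s H differentiable (at (Y, p) within {(Y', p'). \<forall>k. 0 \<le> p' $ k})"
proof -
  let ?S = "herm_sqrt (gram H)"
  define m where "m k j w = snd w $ j * (cmod (\<Sum>i\<in>UNIV. ?S $ k $ i * fst w $ i $ j))\<^sup>2"
    for k j and w :: "(complex^'k^'k) \<times> (real^'k)"
  define I where "I k w = (alpha_q s)\<^sup>2 * (\<Sum>j\<in>UNIV - {k}. m k j w)
     + alpha_q s * beta_q s * (\<Sum>j\<in>UNIV. m k j w) + noise_var s" for k w
  define R where "R w = (\<Sum>k\<in>UNIV. ln (1 + (alpha_q s)\<^sup>2 * m k k w / I k w) / ln 2)" for w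
  define f where "f w = lifted_value s (R w) (bandwidth s * (R w / P_tot s (snd w)))" for w
  let ?Q = "{(Y' :: complex^'k^'k, p' :: real^'k). \<forall>k. 0 \<le> p' $ k}"
  let ?F = "at (Y, p) within ?Q"
  have m: "m k j (Y', p') = (cmod ((gram H ** lift_T H Y' p') $ k $ j))\<^sup>2" if "\<forall>k. 0 \<le> p' $ k" for k j Y' p'
  proof -
    have "(gram H ** lift_T H Y' p') $ k $ j = (\<Sum>i\<in>UNIV. ?S $ k $ i * Y' $ i $ j) * complex_of_real (sqrt (p' $ j))"
      unfolding gram_mult_lift_T [OF pd] mult_diag_mat_nth by (simp add: matrix_matrix_mult_def sqrt_vec_def)
    then show ?thesis using that by (simp add: m_def norm_mult power_mult_distrib mult.commute)
  qed
  have I: "I k (Y', p') = interference s (gram H ** lift_T H Y' p') k" if "\<forall>k. 0 \<le> p' $ k" for k Y' p'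
    using that by (simp add: I_def m interference_def)
  have f: "f (Y', p') = objective_T s H (Y', p')" if "\<forall>k. 0 \<le> p' $ k" for Y' p'
    using that by (simp add: f_def objective_T_lift R_def rate_interference m I log_def)
  have dm: "m k j differentiable ?F" for k j
  proof -
    have "(\<lambda>w :: (complex^'k^'k) \<times> (real^'k). fst w $ i $ j) differentiable ?F" for i
      by (intro bounded_linear_imp_differentiable bounded_linear_compose [OF bounded_linear_vec_nth] bounded_linear_fst)
    moreover have "(\<lambda>w :: (complex^'k^'k) \<times> (real^'k). snd w $ j) differentiable ?F"
      by (intro bounded_linear_imp_differentiable bounded_linear_compose [OF bounded_linear_vec_nth] bounded_linear_snd)
    ultimately show ?thesis
      unfolding m_def by (intro differentiable_mult differentiable_power2_cmod differentiable_sum ballI differentiable_const) auto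
  qed
  have dI: "I k differentiable ?F" for k
    unfolding I_def by (intro differentiable_add differentiable_mult differentiable_sum ballI dm differentiable_const) auto
  have Ipos: "0 < I k (Y, p)" for k
    using p interference_pos [OF s] by (simp add: I)
  have arg: "0 < 1 + (alpha_q s)\<^sup>2 * m k k (Y, p) / I k (Y, p)" for k
    using Ipos [of k] p by (intro add_pos_nonneg) (auto simp: m)
  have dR: "R differentiable ?F"
    unfolding R_def using Ipos arg
    by (intro differentiable_sum ballI differentiable_divide differentiable_ln differentiable_add
        differentiable_mult dm dI differentiable_const) (auto simp: less_imp_neq [symmetric])
  have "(\<lambda>w :: (complex^'k^'k) \<times> (real^'k). snd w $ j) differentiable ?F" for j
    by (intro bounded_linear_imp_differentiable bounded_linear_compose [OF bounded_linear_vec_nth] bounded_linear_snd)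
  then have dP: "(\<lambda>w. P_tot s (snd w)) differentiable ?F"
    unfolding P_tot_def tx_power_def using s
    by (intro differentiable_add differentiable_divide differentiable_mult differentiable_sum ballI differentiable_const)
       (auto simp: valid_system_def)
  have "P_tot s p \<noteq> 0" using P_tot_ge_static [OF s p] p_static_pos [OF s] by linarith
  then have "f differentiable ?F"
    unfolding f_def lifted_value_def using s
    by (intro differentiable_add differentiable_divide differentiable_mult dR dP differentiable_const)
       (auto simp: valid_system_def)
  then show ?thesis
    by (rule differentiable_transform_within [where d = 1]) (use p f in auto)
qed

lemma objective_T_gradient:
  fixes H :: "complex^'n^'k"
  assumes "valid_system s" and "pos_def (gram H)" and "\<And>k. 0 \<le> p $ k"
  obtains GY gp where "(objective_T s H has_derivative (\<lambda>(dY, dp). inner GY dY + inner gp dp))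
      (at (Y, p) within {(Y', p'). \<forall>k. 0 \<le> p' $ k})"
proof -
  obtain D where D: "(objective_T s H has_derivative D) (at (Y, p) within {(Y', p'). \<forall>k. 0 \<le> p' $ k})"
    using objective_T_differentiable [OF assms] unfolding differentiable_def by blast
  have "D w = inner (fst (adjoint D 1)) (fst w) + inner (snd (adjoint D 1)) (snd w)" for w
    using adjoint_works [OF has_derivative_linear [OF D], of w 1]
    by (simp add: inner_prod_def inner_commute)
  then have "D = (\<lambda>(dY, dp). inner (fst (adjoint D 1)) dY + inner (snd (adjoint D 1)) dp)"
    by (simp add: fun_eq_iff)
  then show thesis using D that by metis
qed

lemma differentiable_mse:
  fixes C :: "real \<Rightarrow> complex^'k^'k"
  assumes "\<And>k j. (\<lambda>\<tau>. C \<tau> $ k $ j) differentiable (at a)"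
  shows "(\<lambda>\<tau>. mse s (C \<tau>) u k) differentiable (at a)"
  unfolding mse_def
  by (intro differentiable_add differentiable_mult differentiable_diff differentiable_sum ballI
      differentiable_power2_cmod differentiable_const assms) auto

lemma differentiable_rate_minorizer:
  fixes Z :: "real \<Rightarrow> complex^'k^'k"
  assumes "\<And>k j. (\<lambda>\<tau>. (Hb ** Z \<tau>) $ k $ j) differentiable (at a)"
  shows "(\<lambda>\<tau>. rate_minorizer s Hb Xn (Z \<tau>)) differentiable (at a)"
  unfolding rate_minorizer_def Let_def
  by (intro differentiable_add differentiable_mult differentiable_diff differentiable_sum ballI
      differentiable_mse differentiable_const assms) auto

context sca_limit
begin

text \<open>Along the curve, \<open>g\<close> is the surrogate and \<open>h\<close> the objective of
  (T). Near \<open>0\<close>, on both sides and regardless of the norm and budget constraints,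
  \<open>g \<le> h\<close> with equality at \<open>0\<close>, which equates the derivatives;
  feasibility for small positive \<open>\<tau>\<close> then gives the sign of the derivative of
  \<open>g\<close>. The condition on \<open>dp\<close> keeps the curve smooth and the powers
  nonnegative on both sides.\<close>

lemma first_order:
  fixes Y dY :: "complex^'k^'k" and dp :: "real^'k"
  assumes pd: "pos_def (gram H)" and X: "X = lift_T H Y p"
    and D: "(objective_T s H has_derivative (\<lambda>(dY, dp). inner GY dY + inner gp dp))
      (at (Y, p) within {(Y', p'). \<forall>k. 0 \<le> p' $ k})"
    and dp: "\<And>j. p $ j = 0 \<Longrightarrow> dp $ j = 0"
    and "0 < e"
    and feas: "\<And>\<tau>. 0 < \<tau> \<Longrightarrow> \<tau> < e \<Longrightarrow> spectral_norm (Y + \<tau> *\<^sub>R dY) \<le> 1 \<and> tx_power s (p + \<tau> *\<^sub>R dp) \<le> p_max s"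
  shows "inner GY dY + inner gp dp \<le> 0"
proof -
  let ?Q = "{(Y' :: complex^'k^'k, p' :: real^'k). \<forall>k. 0 \<le> p' $ k}"
  have p: "0 \<le> p $ k" for k using loewner_le_gram_nonneg [OF limit_loewner] .
  define Z where "Z \<tau> = lift_T H (Y + \<tau> *\<^sub>R dY) (p + \<tau> *\<^sub>R dp)" for \<tau>
  define q where "q \<tau> = rate_minorizer s (gram H) X (Z \<tau>)" for \<tau>
  define \<psi> where "\<psi> \<tau> = ratio_minorizer x y (sqrt (q \<tau>)) (P_tot s (p + \<tau> *\<^sub>R dp))" for \<tau>
  define g where "g \<tau> = lifted_value s (q \<tau>) (bandwidth s * \<psi> \<tau>)" for \<tau>
  define h where "h \<tau> = objective_T s H (Y + \<tau> *\<^sub>R dY, p + \<tau> *\<^sub>R dp)" for \<tau>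
  have q0: "q 0 = r"
    using rate_minorizer_touches [OF s, of "gram H" X] limit_tight(1) by (simp add: q_def Z_def flip: X)
  have \<psi>0: "\<psi> 0 = r / y"
    using limit_pos(2) limit_tight(2) limit_tight(3) ratio_minorizer_touches [of x y] by (simp add: \<psi>_def q0)
  have g0: "g 0 = lifted_value s r t"
    unfolding g_def q0 \<psi>0 limit_tight(4) [symmetric] ..
  have h0: "h 0 = lifted_value s r t"
    using limit_tight(4) unfolding h_def objective_T_lift
    by (simp add: limit_tight(1) [symmetric] limit_tight(3) [symmetric] flip: X)
  \<comment> \<open>Where \<open>p $ j = 0\<close> the function is constant.\<close>
  have dsqrt: "(\<lambda>\<tau>. sqrt (p $ j + \<tau> * dp $ j)) differentiable (at 0)" for j
  proof (cases "p $ j = 0")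
    case False
    then have "0 < p $ j" using p [of j] by simp
    then show ?thesis by (intro differentiable_sqrt) auto
  qed (simp add: dp)
  have dC: "(\<lambda>\<tau>. (gram H ** Z \<tau>) $ k $ j) differentiable (at 0)" for k j
  proof -
    have "(\<lambda>\<tau>. \<tau> *\<^sub>R dY $ i $ j) differentiable (at 0)" for i
      by (intro bounded_linear_imp_differentiable bounded_linear_scaleR_left)
    moreover have "(gram H ** Z \<tau>) $ k $ j = (\<Sum>i\<in>UNIV. herm_sqrt (gram H) $ k $ i * (Y $ i $ j + \<tau> *\<^sub>R dY $ i $ j))
        * complex_of_real (sqrt (p $ j + \<tau> * dp $ j))" for \<tau>
      unfolding Z_def gram_mult_lift_T [OF pd] mult_diag_mat_nth by (simp add: matrix_matrix_mult_def sqrt_vec_def)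
    ultimately show ?thesis
      by (simp only:) (intro differentiable_mult differentiable_sum ballI differentiable_add differentiable_const
          differentiable_of_real dsqrt; simp)
  qed
  have dq: "q differentiable (at 0)"
    unfolding q_def by (intro differentiable_rate_minorizer dC)
  have dP: "(\<lambda>\<tau>. P_tot s (p + \<tau> *\<^sub>R dp)) differentiable (at 0)"
    unfolding P_tot_def tx_power_def using s by (simp add: valid_system_def)
  have d\<psi>: "\<psi> differentiable (at 0)"
    unfolding \<psi>_def ratio_minorizer_def using limit_pos(1)
    by (intro differentiable_diff differentiable_mult differentiable_const differentiable_sqrt dq dP) (simp add: q0)
  have "g differentiable (at 0)"
    unfolding g_def lifted_value_def using s
    by (intro differentiable_add differentiable_mult differentiable_divide differentiable_const dq d\<psi>)
       (auto simp: valid_system_def)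
  then obtain g' where g': "(g has_real_derivative g') (at 0)"
    using real_differentiable_def by blast
  have "\<forall>\<^sub>F \<tau> in nhds 0. 0 \<le> p $ k + \<tau> * dp $ k" for k
  proof (cases "p $ k = 0")
    case False
    then have "0 < p $ k" using p [of k] by simp
    moreover have "((\<lambda>\<tau>. p $ k + \<tau> * dp $ k) \<longlongrightarrow> p $ k + 0 * dp $ k) (nhds 0)"
      by (intro tendsto_intros filterlim_ident)
    ultimately show ?thesis
      using order_tendstoD(1) [of "\<lambda>\<tau>. p $ k + \<tau> * dp $ k" "p $ k" "nhds 0" 0] by (auto elim: eventually_mono)
  qed (simp add: dp)
  then have ev1: "\<forall>\<^sub>F \<tau> in nhds 0. \<forall>k. 0 \<le> p $ k + \<tau> * dp $ k"
    by (rule eventually_all_finite)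
  have "(q \<longlongrightarrow> q 0) (nhds 0)" "(\<psi> \<longlongrightarrow> \<psi> 0) (nhds 0)"
    using differentiable_imp_continuous_within [OF dq] differentiable_imp_continuous_within [OF d\<psi>]
    by (simp_all add: continuous_at tendsto_at_iff_tendsto_nhds)
  then have "\<forall>\<^sub>F \<tau> in nhds 0. 0 < q \<tau>" "\<forall>\<^sub>F \<tau> in nhds 0. 0 < \<psi> \<tau>"
    using limit_pos(1) limit_power(2) by (auto intro: order_tendstoD(1) simp: q0 \<psi>0)
  with ev1 have "\<forall>\<^sub>F \<tau> in nhds 0. (\<forall>k. 0 \<le> p $ k + \<tau> * dp $ k) \<and> 0 < q \<tau> \<and> 0 < \<psi> \<tau>"
    by eventually_elim simp
  then obtain d where "0 < d" and d: "\<And>\<tau>. \<bar>\<tau>\<bar> < d \<Longrightarrow> (\<forall>k. 0 \<le> p $ k + \<tau> * dp $ k) \<and> 0 < q \<tau> \<and> 0 < \<psi> \<tau>"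
    unfolding eventually_nhds_metric by (auto simp: dist_real_def)
  \<comment> \<open>For parameters in the open ball the curve stays in the set within which
    \<open>objective_T\<close> is differentiated, so the one-sided notion of gradient yields a
    two-sided derivative.\<close>
  have h': "(h has_real_derivative (inner GY dY + inner gp dp)) (at 0)"
  proof -
    let ?\<gamma> = "\<lambda>\<tau>. (Y + \<tau> *\<^sub>R dY, p + \<tau> *\<^sub>R dp)"
    have "(?\<gamma> has_derivative (\<lambda>\<tau>. (\<tau> *\<^sub>R dY, \<tau> *\<^sub>R dp))) (at 0 within ball 0 d)"
      by (auto intro!: derivative_eq_intros)
    moreover have "?\<gamma> ` ball 0 d \<subseteq> ?Q"
      using d by (auto simp: dist_real_def)
    then have "(objective_T s H has_derivative (\<lambda>(dY, dp). inner GY dY + inner gp dp)) (at (?\<gamma> 0) within ?\<gamma> ` ball 0 d)"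
      using has_derivative_subset [OF D] by simp
    ultimately have "((objective_T s H \<circ> ?\<gamma>) has_derivative
        ((\<lambda>(dY, dp). inner GY dY + inner gp dp) \<circ> (\<lambda>\<tau>. (\<tau> *\<^sub>R dY, \<tau> *\<^sub>R dp)))) (at 0 within ball 0 d)"
      by (rule diff_chain_within)
    then have "(h has_derivative (\<lambda>\<tau>. (inner GY dY + inner gp dp) * \<tau>)) (at 0)"
      using \<open>0 < d\<close> by (simp add: o_def h_def [abs_def] at_within_open [of 0 "ball 0 d"] algebra_simps)
    then show ?thesis by (simp add: has_field_derivative_def)
  qed
  have "g \<tau> \<le> h \<tau>" if "\<bar>\<tau>\<bar> < d" for \<tau>
  proof -
    let ?R = "rate s (gram H ** Z \<tau>)" and ?P = "P_tot s (p + \<tau> *\<^sub>R dp)"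
    have P: "0 < ?P"
      using d [OF that] P_tot_ge_static [OF s, of "p + \<tau> *\<^sub>R dp"] p_static_pos [OF s] by fastforce
    have "q \<tau> \<le> ?R" unfolding q_def by (rule rate_minorizer_le [OF s])
    have "\<psi> \<tau> \<le> (sqrt (q \<tau>))\<^sup>2 / ?P" unfolding \<psi>_def by (rule ratio_minorizer_le [OF P])
    also have "\<dots> = q \<tau> / ?P" using d [OF that] by simp
    also have "\<dots> \<le> ?R / ?P" using \<open>q \<tau> \<le> ?R\<close> P by (intro divide_right_mono) auto
    finally have "bandwidth s * \<psi> \<tau> \<le> bandwidth s * (?R / ?P)"
      using s by (intro mult_left_mono) (auto simp: valid_system_def)
    then show ?thesis
      unfolding g_def h_def objective_T_lift Z_def [symmetric] using \<open>q \<tau> \<le> ?R\<close> by (intro lifted_value_mono s)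
  qed
  \<comment> \<open>The difference of \<open>h\<close> and \<open>g\<close> has a local minimum at
    \<open>0\<close>.\<close>
  then have "inner GY dY + inner gp dp - g' = 0"
    using \<open>0 < d\<close> by (intro DERIV_local_min [OF DERIV_diff [OF h' g'], of d]) (auto simp: g0 h0)
  \<comment> \<open>A positive slope would let a feasible point with small positive
    \<open>\<tau>\<close> beat the limit value.\<close>
  moreover have "g' \<le> 0"
  proof (rule ccontr)
    assume "\<not> g' \<le> 0"
    then obtain c where "0 < c" and c: "\<And>\<tau>. 0 < \<tau> \<Longrightarrow> \<tau> < c \<Longrightarrow> g 0 < g \<tau>"
      using DERIV_pos_inc_right [OF g'] by auto
    define \<tau> where "\<tau> = min (min c d) e / 2"
    have \<tau>: "0 < \<tau>" "\<tau> < c" "\<tau> < d" "\<tau> < e"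
      using \<open>0 < c\<close> \<open>0 < d\<close> \<open>0 < e\<close> by (auto simp: \<tau>_def)
    have "g \<tau> \<le> lifted_value s r t"
      unfolding g_def \<psi>_def q_def
    proof (rule limit_maximal)
      show "loewner_le (ctranspose (Z \<tau>) ** gram H ** Z \<tau>) (diag_mat (p + \<tau> *\<^sub>R dp))"
        unfolding Z_def using feas [OF \<tau>(1,4)] d [of \<tau>] \<tau> by (intro loewner_le_lift_T pd) auto
    qed (use feas [OF \<tau>(1,4)] d [of \<tau>] \<tau> in \<open>auto simp: q_def \<psi>_def\<close>)
    then show False using c [OF \<tau>(1,2)] by (simp add: g0)
  qed
  ultimately show ?thesis by simp
qed

lemma tx_power_axis: "tx_power s (q + \<tau> *\<^sub>R axis j c) = tx_power s q + alpha_q s * (\<tau> * c)" for q :: "real^'k"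
proof -
  have "(\<Sum>k\<in>UNIV. \<tau> * axis j c $ k) = (\<Sum>k\<in>UNIV. if k = j then \<tau> * c else 0)"
    by (rule sum.cong) (auto simp: axis_def)
  then show ?thesis by (simp add: tx_power_def sum.distrib distrib_left)
qed

text \<open>
  On \<open>p $ j = 0\<close> the \<open>j\<close>-th column of \<open>Y\<close> vanishes, so increasing \<open>p $ j\<close> only increases the
  consumed power.
\<close>

lemma gradient_power_nonpos:
  fixes Y :: "complex^'k^'k"
  assumes pd: "pos_def (gram H)"
    and D: "(objective_T s H has_derivative (\<lambda>(dY, dp). inner GY dY + inner gp dp))
      (at (Y, p) within {(Y', p'). \<forall>k. 0 \<le> p' $ k})"
    and Yj: "\<And>i. Y $ i $ j = 0"
  shows "gp $ j \<le> 0"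
proof -
  have p: "0 \<le> p $ k" for k using loewner_le_gram_nonneg [OF limit_loewner] .
  define h where "h \<tau> = objective_T s H (Y, p + \<tau> *\<^sub>R axis j 1)" for \<tau>
  let ?\<gamma> = "\<lambda>\<tau>. (Y, p + \<tau> *\<^sub>R axis j 1)"
  \<comment> \<open>Only a right-hand derivative is available, since \<open>p $ j\<close> may be
    zero.\<close>
  have "(?\<gamma> has_derivative (\<lambda>\<tau>. (0, \<tau> *\<^sub>R axis j 1))) (at 0 within {0..})"
    by (auto intro!: derivative_eq_intros)
  moreover have "?\<gamma> ` {0..} \<subseteq> {(Y', p'). \<forall>k. 0 \<le> p' $ k}"
    using p by (auto simp: axis_def)
  then have "(objective_T s H has_derivative (\<lambda>(dY, dp). inner GY dY + inner gp dp)) (at (?\<gamma> 0) within ?\<gamma> ` {0..})"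
    using has_derivative_subset [OF D] by simp
  ultimately have "((objective_T s H \<circ> ?\<gamma>) has_derivative
      ((\<lambda>(dY, dp). inner GY dY + inner gp dp) \<circ> (\<lambda>\<tau>. (0, \<tau> *\<^sub>R axis j 1)))) (at 0 within {0..})"
    by (rule diff_chain_within)
  then have h': "(h has_real_derivative gp $ j) (at 0 within {0..})"
    by (simp add: o_def h_def [abs_def] has_field_derivative_def inner_axis mult_commute_abs)
  have h_le: "h \<tau> \<le> h 0" if "0 \<le> \<tau>" for \<tau>
  proof -
    have eq: "gram H ** lift_T H Y (p + \<tau> *\<^sub>R axis j 1) = gram H ** lift_T H Y p"
    proof -
      have "(Y ** diag_mat (sqrt_vec (p + \<tau> *\<^sub>R axis j 1))) = Y ** diag_mat (sqrt_vec p)"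
        using Yj by (auto simp: vec_eq_iff mult_diag_mat_nth sqrt_vec_def axis_def)
      then show ?thesis by (simp add: gram_mult_lift_T [OF pd] flip: matrix_mul_assoc)
    qed
    let ?R = "rate s (gram H ** lift_T H Y p)"
    have "0 \<le> ?R" by (rule rate_nonneg [OF s])
    have "tx_power s p \<le> tx_power s (p + \<tau> *\<^sub>R axis j 1)"
      unfolding tx_power_axis using that alpha_q_pos [OF s] by simp
    then have "P_tot s p \<le> P_tot s (p + \<tau> *\<^sub>R axis j 1)"
      using s by (simp add: P_tot_def valid_system_def divide_right_mono)
    moreover have "0 < P_tot s p" using limit_tight(3) limit_power(2) by simp
    ultimately have "?R / P_tot s (p + \<tau> *\<^sub>R axis j 1) \<le> ?R / P_tot s p"
      using \<open>0 \<le> ?R\<close> by (intro divide_left_mono) auto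
    then have "bandwidth s * (?R / P_tot s (p + \<tau> *\<^sub>R axis j 1)) \<le> bandwidth s * (?R / P_tot s p)"
      using s by (intro mult_left_mono) (auto simp: valid_system_def)
    then show ?thesis
      unfolding h_def objective_T_lift eq by (simp add: lifted_value_mono [OF s])
  qed
  show ?thesis
  proof (rule ccontr)
    assume "\<not> gp $ j \<le> 0"
    then obtain d where "0 < d" "\<And>\<tau>. 0 < \<tau> \<Longrightarrow> 0 + \<tau> \<in> {0..} \<Longrightarrow> \<tau> < d \<Longrightarrow> h 0 < h (0 + \<tau>)"
      using has_real_derivative_pos_inc_right [OF h'] by auto
    then have "h 0 < h (d / 2)" by fastforce
    then show False using h_le [of "d / 2"] \<open>0 < d\<close> by simp
  qed
qed

text \<open>On streams with positive power the components of \<open>gp\<close> agree, and their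
  common value divided by \<open>alpha_q s\<close> is \<open>m\<close>. On the others
  \<open>n\<close> absorbs the difference, which has the right sign by \<open>gp0\<close>.\<close>

lemma limit_KKT:
  assumes pd: "pos_def (gram H)"
  shows "\<exists>Y. ctranspose H ** X = precoder_T H Y p \<and> KKT_T s H (Y, p)"
proof -
  obtain Y where X: "X = lift_T H Y p" and Y: "spectral_norm Y \<le> 1"
    and Y0: "\<And>i j. p $ j = 0 \<Longrightarrow> Y $ i $ j = 0"
    using loewner_le_gram_obtain_contraction [OF pd limit_loewner] by blast
  have p: "0 \<le> p $ k" for k using loewner_le_gram_nonneg [OF limit_loewner] .
  have \<alpha>: "0 < alpha_q s" using alpha_q_pos [OF s] .
  obtain GY gp where D: "(objective_T s H has_derivative (\<lambda>(dY, dp). inner GY dY + inner gp dp))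
      (at (Y, p) within {(Y', p'). \<forall>k. 0 \<le> p' $ k})"
    using objective_T_gradient [OF s pd p] by blast
  have fo: "inner gp dp \<le> 0"
    if "\<And>j. p $ j = 0 \<Longrightarrow> dp $ j = 0" "0 < e"
      "\<And>\<tau>. 0 < \<tau> \<Longrightarrow> \<tau> < e \<Longrightarrow> tx_power s (p + \<tau> *\<^sub>R dp) \<le> p_max s" for dp e
    using first_order [OF pd X D that(1,2), where dY = 0] that(3) Y by simp
  have "inner GY (Z - Y) \<le> 0" if "spectral_norm Z \<le> 1" for Z
  proof -
    have "spectral_norm (Y + \<tau> *\<^sub>R (Z - Y)) \<le> 1" if "0 < \<tau>" "\<tau> < 1" for \<tau>
    proof -
      have "Y + \<tau> *\<^sub>R (Z - Y) = (1 - \<tau>) *\<^sub>R Y + \<tau> *\<^sub>R Z" by (simp add: algebra_simps)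
      then have "spectral_norm (Y + \<tau> *\<^sub>R (Z - Y)) \<le> (1 - \<tau>) * spectral_norm Y + \<tau> * spectral_norm Z"
        using spectral_norm_triangle [of "(1 - \<tau>) *\<^sub>R Y" "\<tau> *\<^sub>R Z"] that by (simp add: spectral_norm_scaleR)
      also have "\<dots> \<le> (1 - \<tau>) * 1 + \<tau> * 1"
        using that Y \<open>spectral_norm Z \<le> 1\<close> by (intro add_mono mult_left_mono) auto
      finally show ?thesis by simp
    qed
    then show ?thesis
      using first_order [OF pd X D, where dp = 0 and dY = "Z - Y" and e = 1] limit_power(4) by simp
  qed
  then obtain l V where lV: "0 \<le> l" "subgradient spectral_norm Y V" "GY = l *\<^sub>R V" "l * (spectral_norm Y - 1) = 0"
    using spectral_ball_stationary [OF Y] by blast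
  have gp0: "gp $ j \<le> 0" if "p $ j = 0" for j
    using gradient_power_nonpos [OF pd D] Y0 that by blast
  have gp_nonneg: "0 \<le> gp $ j" if "p $ j \<noteq> 0" for j
  proof -
    have "inner gp (axis j (-1)) \<le> 0"
    \<comment> \<open>Any positive \<open>e\<close> serves: lowering power respects the budget, and
      \<open>first_order\<close> itself restricts to nonnegative powers.\<close>
    proof (rule fo [where e = 1])
      show "tx_power s (p + \<tau> *\<^sub>R axis j (-1)) \<le> p_max s" if "0 < \<tau>" for \<tau>
        using limit_power(4) mult_pos_pos [OF \<alpha> that] unfolding tx_power_axis by simp
    qed (use that in \<open>auto simp: axis_def\<close>)
    then show ?thesis by (simp add: inner_axis)
  qed
  have gp_slack: "gp $ j \<le> 0" if "p $ j \<noteq> 0" "tx_power s p \<noteq> p_max s" for j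
  proof -
    have pos: "0 < p_max s - tx_power s p" using limit_power(4) that(2) by simp
    have "inner gp (axis j 1) \<le> 0"
    \<comment> \<open>The length at which the budget is exhausted, as \<open>tx_power\<close> grows
      at rate \<open>alpha_q s\<close>.\<close>
    proof (rule fo [where e = "(p_max s - tx_power s p) / alpha_q s"])
      show "tx_power s (p + \<tau> *\<^sub>R axis j 1) \<le> p_max s" if "\<tau> < (p_max s - tx_power s p) / alpha_q s" for \<tau>
        using that \<alpha> unfolding tx_power_axis by (simp add: field_simps)
    qed (use that pos \<alpha> in \<open>auto simp: axis_def\<close>)
    then show ?thesis by (simp add: inner_axis)
  qed
  have gp_eq: "gp $ i \<le> gp $ j" if "p $ i \<noteq> 0" "p $ j \<noteq> 0" for i j
  proof -
    \<comment> \<open>Moving power from stream \<open>j\<close> to stream \<open>i\<close> leaves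
      the budget unchanged, so this works even when the budget is tight.\<close>
    have "inner gp (axis i 1 - axis j 1) \<le> 0"
    proof (rule fo [where e = 1])
      fix \<tau> :: real
      have eq: "p + \<tau> *\<^sub>R (axis i 1 - axis j 1) = p + \<tau> *\<^sub>R axis i 1 + (- \<tau>) *\<^sub>R axis j 1"
        by (simp add: algebra_simps)
      have "tx_power s (p + \<tau> *\<^sub>R (axis i 1 - axis j 1)) = tx_power s p"
        unfolding eq tx_power_axis by simp
      then show "tx_power s (p + \<tau> *\<^sub>R (axis i 1 - axis j 1)) \<le> p_max s"
        using limit_power(4) by simp
    qed (use that in \<open>auto simp: axis_def\<close>)
    then show ?thesis by (simp add: inner_diff_right inner_axis)
  qed
  obtain m where "0 \<le> m" and m: "\<And>j. p $ j \<noteq> 0 \<Longrightarrow> gp $ j = m * alpha_q s" and ms: "m * (tx_power s p - p_max s) = 0"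
  proof (cases "tx_power s p = p_max s \<and> (\<exists>i. p $ i \<noteq> 0)")
    case True
    then obtain i where i: "p $ i \<noteq> 0" by blast
    show thesis
    proof
      show "0 \<le> gp $ i / alpha_q s" using gp_nonneg [OF i] \<alpha> by simp
      show "gp $ j = gp $ i / alpha_q s * alpha_q s" if "p $ j \<noteq> 0" for j
        using gp_eq [OF i that] gp_eq [OF that i] \<alpha> by simp
      show "gp $ i / alpha_q s * (tx_power s p - p_max s) = 0" using True by simp
    qed
  next
    \<comment> \<open>Either the budget is slack, and the gradient vanishes on active streams, or
      there are no active streams; \<open>m = 0\<close> serves both.\<close>
    case False
    show thesis
    proof
      show "gp $ j = 0 * alpha_q s" if "p $ j \<noteq> 0" for j
        using gp_nonneg [OF that] gp_slack [OF that] False that by (auto intro: antisym)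
    qed simp_all
  qed
  define n where "n = (\<chi> k. m * alpha_q s - gp $ k)"
  have "\<forall>k. 0 \<le> n $ k"
  proof
    show "0 \<le> n $ k" for k
      using m [of k] gp0 [of k] mult_nonneg_nonneg [OF \<open>0 \<le> m\<close> less_imp_le [OF \<alpha>]]
      by (cases "p $ k = 0") (simp_all add: n_def)
  qed
  moreover have "\<forall>k. n $ k * p $ k = 0" using m by (auto simp: n_def)
  moreover have "\<forall>k. gp $ k = m * alpha_q s - n $ k" by (simp add: n_def)
  moreover have "feasible_T s (Y, p)" using p Y limit_power(4) by (simp add: feasible_T_def)
  ultimately have "KKT_T s H (Y, p)"
    unfolding KKT_T_def prod.case using D lV \<open>0 \<le> m\<close> ms by blast
  then show ?thesis using ctranspose_mult_lift_T [of H Y p] X by metis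
qed

end

theorem mainTheorem6:
  fixes s :: system
    and H :: "complex^'n^'k"
    and z :: "nat \<Rightarrow> 'k point"
  assumes "valid_system s"
    and "CARD('k) \<le> CARD('n)"
    and "rank H = CARD('k)"
    and "sca_sequence s (gram H) z"
  shows "(\<forall>n. convex_program (subproblem s (gram H) (z n)) \<and>
              feasible (subproblem s (gram H) (z n)) (z n)) \<and>
         (\<forall>n. feasible (problem_L s (gram H)) (z n)) \<and>
         incseq (\<lambda>n. objective (problem_L s (gram H)) (z n)) \<and>
         convergent (\<lambda>n. objective (problem_L s (gram H)) (z n)) \<and>
         ((\<exists>n. 0 < x_part (z n)) \<longrightarrow>
           (\<forall>X p r t x y. limit_point z (X, p, r, t, x, y) \<longrightarrow>
             (\<exists>Y. ctranspose H ** X = precoder_T H Y p \<and> KKT_T s H (Y, p))))"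
proof -
  have "\<exists>Y. ctranspose H ** X = precoder_T H Y p \<and> KKT_T s H (Y, p)"
    if active: "\<exists>n. 0 < x_part (z n)" and "limit_point z (X, p, r, t, x, y)" for X p r t x y
  proof -
    from that(2) obtain \<kappa> where \<kappa>: "strict_mono \<kappa>" "(z \<circ> \<kappa>) \<longlonglongrightarrow> (X, p, r, t, x, y)"
      unfolding limit_point_def by blast
    interpret sca_limit s H z \<kappa> X p r t x y
      using assms \<kappa> active by unfold_locales
    show ?thesis by (rule limit_KKT [OF pos_def_gram [OF assms(3)]])
  qed
  then show ?thesis
    using convex_program_subproblem [OF assms(1)] sca_sequence_feasible [OF assms(1,4)]
      feasible_problem_L_imp_subproblem [OF assms(1)] sca_incseq [OF assms(1,4)] sca_convergent [OF assms(1,4)]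
    by blast
qed

end
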